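(* There is an absolute constant $c>0$ such that the following holds over every field $\mathbb{F}$. Let $C=\sum_{i=1}^k T_i$ be a $\Sigma\Pi\Sigma(k,d)$ circuit over $\mathbb{F}$ that is simple, minimal and identically zero. Then $\mathrm{rank}(C)\le c\,k^3\log d$, i.e. $\mathrm{rank}(C)=O(k^3\log d)$.
   Context: Let $R=\mathbb{F}[x_1,\dots,x_n]$. A linear form is a polynomial $\sum_{i=1}^n a_ix_i$ with $a_i\in\mathbb{F}$. A $\Sigma\Pi\Sigma(k,d)$ circuit is an expression $C=\sum_{i=1}^k T_i$ where each multiplication term $T_i=\alpha_i\prod_{j=1}^{d}\ell_{i,j}$ with $\alpha_i\in\mathbb{F}^*$ and each $\ell_{i,j}$ a linear form; $k$ is the top fanin and $d$ the degree. $C$ is simple if no nonzero linear form divides all the $T_i$. $C$ is minimal if for every proper subset $S\subsetneq[k]$, $\sum_{i\in S}T_i\neq 0$. $C$ is an identity (zero) if $\sum_i T_i$ is the zero polynomial. The rank of $C$ is the dimension of the $\mathbb{F}$-span of all the linear forms $\ell_{i,j}$ (viewed as vectors in $\mathbb{F}^n$).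
   Formalization: The degree is assumed to satisfy d ≥ 2 (for d = 1 the identity x₁ + x₂ − (x₁+x₂) is simple and minimal with rank 2 while log 1 = 0; for d = 0 log d is undefined), and minimality is required only over nonempty proper subsets S. *)

theory Defs
  imports Complex_Main "HOL-Algebra.Indexed_Polynomials" "HOL-Algebra.Embedded_Algebras"
begin

text \<open>
  \<open>mpoly_ring F n\<close> is \<open>F[x\<^sub>0, \<dots>, x\<^sub>n\<^sub>-\<^sub>1]\<close>. Its elements are the indexed polynomials of
  \<open>HOL-Algebra.Indexed_Polynomials\<close>: functions from monomials (multisets of variables) to
  coefficients. That theory has no product of two polynomials, so the convolution product is
  supplied here; the monomials \<open>M \<subseteq># m\<close> are the divisors of \<open>m\<close>.
\<close>

definition mpoly_ring :: "('a, 'b) ring_scheme \<Rightarrow> nat \<Rightarrow> (nat multiset \<Rightarrow> 'a) ring" where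
  "mpoly_ring F n =
    \<lparr>carrier = ring.indexed_pset F {..<n} (carrier F),
     monoid.mult = (\<lambda>P Q m. \<Oplus>\<^bsub>F\<^esub>M\<in>{M. M \<subseteq># m}. P M \<otimes>\<^bsub>F\<^esub> Q (m - M)),
     monoid.one = ring.indexed_const F \<one>\<^bsub>F\<^esub>,
     ring.zero = ring.indexed_const F \<zero>\<^bsub>F\<^esub>,
     ring.add = ring.indexed_padd F\<rparr>"

definition constants :: "('a, 'b) ring_scheme \<Rightarrow> (nat multiset \<Rightarrow> 'a) set" where
  "constants F = ring.indexed_const F ` carrier F"

text \<open>The linear forms are homogeneous, and \<open>0\<close> is one of them.\<close>

definition linear_forms :: "('a, 'b) ring_scheme \<Rightarrow> nat \<Rightarrow> (nat multiset \<Rightarrow> 'a) set" where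
  "linear_forms F n =
    {\<Oplus>\<^bsub>mpoly_ring F n\<^esub>i\<in>{..<n}. ring.indexed_const F (a i) \<otimes>\<^bsub>mpoly_ring F n\<^esub> ring.indexed_var F i
      | a. a \<in> {..<n} \<rightarrow> carrier F}"

text \<open>
  A \<open>\<Sigma>\<Pi>\<Sigma>(k, d)\<close> circuit is an expression, hence represented by its data: the scalars
  \<open>\<alpha> i\<close> (\<open>i < k\<close>) and the linear forms \<open>l i j\<close> (\<open>i < k\<close>, \<open>j < d\<close>). Values of \<open>\<alpha>\<close> and \<open>l\<close>
  outside these ranges are irrelevant.
\<close>

definition depth3_circuit ::
  "('a, 'b) ring_scheme \<Rightarrow> nat \<Rightarrow> nat \<Rightarrow> nat \<Rightarrow> (nat \<Rightarrow> 'a) \<Rightarrow> (nat \<Rightarrow> nat \<Rightarrow> nat multiset \<Rightarrow> 'a) \<Rightarrow> bool"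
  where
  "depth3_circuit F n k d \<alpha> l \<longleftrightarrow>
    (\<forall>i<k. \<alpha> i \<in> carrier F - {\<zero>\<^bsub>F\<^esub>}) \<and> (\<forall>i<k. \<forall>j<d. l i j \<in> linear_forms F n)"

definition mult_term ::
  "('a, 'b) ring_scheme \<Rightarrow> nat \<Rightarrow> nat \<Rightarrow> (nat \<Rightarrow> 'a) \<Rightarrow> (nat \<Rightarrow> nat \<Rightarrow> nat multiset \<Rightarrow> 'a)
    \<Rightarrow> nat \<Rightarrow> nat multiset \<Rightarrow> 'a"
  where
  "mult_term F n d \<alpha> l i =
    ring.indexed_const F (\<alpha> i) \<otimes>\<^bsub>mpoly_ring F n\<^esub> (\<Otimes>\<^bsub>mpoly_ring F n\<^esub>j\<in>{..<d}. l i j)"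

definition simple_circuit ::
  "('a, 'b) ring_scheme \<Rightarrow> nat \<Rightarrow> nat \<Rightarrow> nat \<Rightarrow> (nat \<Rightarrow> 'a) \<Rightarrow> (nat \<Rightarrow> nat \<Rightarrow> nat multiset \<Rightarrow> 'a) \<Rightarrow> bool"
  where
  "simple_circuit F n k d \<alpha> l \<longleftrightarrow>
    \<not> (\<exists>u \<in> linear_forms F n - {\<zero>\<^bsub>mpoly_ring F n\<^esub>}.
          \<forall>i<k. u divides\<^bsub>mpoly_ring F n\<^esub> mult_term F n d \<alpha> l i)"

text \<open>The empty subset has sum \<open>0\<close>, so it has to be excluded in the definition of minimality.\<close>

definition minimal_circuit ::
  "('a, 'b) ring_scheme \<Rightarrow> nat \<Rightarrow> nat \<Rightarrow> nat \<Rightarrow> (nat \<Rightarrow> 'a) \<Rightarrow> (nat \<Rightarrow> nat \<Rightarrow> nat multiset \<Rightarrow> 'a) \<Rightarrow> bool"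
  where
  "minimal_circuit F n k d \<alpha> l \<longleftrightarrow>
    (\<forall>S. S \<subset> {..<k} \<and> S \<noteq> {} \<longrightarrow>
      (\<Oplus>\<^bsub>mpoly_ring F n\<^esub>i\<in>S. mult_term F n d \<alpha> l i) \<noteq> \<zero>\<^bsub>mpoly_ring F n\<^esub>)"

definition identity_circuit ::
  "('a, 'b) ring_scheme \<Rightarrow> nat \<Rightarrow> nat \<Rightarrow> nat \<Rightarrow> (nat \<Rightarrow> 'a) \<Rightarrow> (nat \<Rightarrow> nat \<Rightarrow> nat multiset \<Rightarrow> 'a) \<Rightarrow> bool"
  where
  "identity_circuit F n k d \<alpha> l \<longleftrightarrow>
    (\<Oplus>\<^bsub>mpoly_ring F n\<^esub>i\<in>{..<k}. mult_term F n d \<alpha> l i) = \<zero>\<^bsub>mpoly_ring F n\<^esub>"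

definition circuit_rank ::
  "('a, 'b) ring_scheme \<Rightarrow> nat \<Rightarrow> nat \<Rightarrow> nat \<Rightarrow> (nat \<Rightarrow> nat \<Rightarrow> nat multiset \<Rightarrow> 'a) \<Rightarrow> nat" where
  "circuit_rank F n k d l =
    ring.dim (mpoly_ring F n) (constants F)
      (ring.Span (mpoly_ring F n) (constants F) [l i j. i \<leftarrow> [0..<k], j \<leftarrow> [0..<d]])"

text \<open>
  The rank bound with constant \<open>c\<close> over one field. The base of the logarithm only affects \<open>c\<close>.
  The degree is at least \<open>2\<close>: for \<open>d = 1\<close> the logarithm vanishes, whereas the simple minimal
  identity with the terms \<open>x\<^sub>0\<close>, \<open>x\<^sub>1\<close> and \<open>- (x\<^sub>0 + x\<^sub>1)\<close> has rank \<open>2\<close>.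
\<close>

definition rank_bound :: "('a, 'b) ring_scheme \<Rightarrow> real \<Rightarrow> bool" where
  "rank_bound F c \<longleftrightarrow>
    (\<forall>n k d \<alpha> l. 2 \<le> d \<longrightarrow> depth3_circuit F n k d \<alpha> l \<longrightarrow> simple_circuit F n k d \<alpha> l \<longrightarrow>
      minimal_circuit F n k d \<alpha> l \<longrightarrow> identity_circuit F n k d \<alpha> l \<longrightarrow>
      real (circuit_rank F n k d l) \<le> c * real k ^ 3 * log 2 (real d))"

text \<open>
  An absolute constant must not depend on the type \<open>'a\<close> that carries the field, but types cannot
  be quantified below \<open>\<exists>c\<close>. In the final theorem the constant is therefore chosen for the fields
  carried by subsets of \<^typ>\<open>nat\<close>, that is, without reference to \<open>'a\<close>; and every constant that is
  valid for these fields is asserted to be valid for every field carried by a subset of \<open>'a\<close>.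
  This is no more than an absolute constant: the data of a circuit generate a countable
  subfield, over which the circuit has the same properties and the same rank.
\<close>

end

theory Submission
  imports Defs "HOL-Library.Multiset_Order" "HOL-Library.Countable_Set"
    "HOL-Algebra.Generated_Fields"
begin

text \<open>
  For a span \<open>K\<close> of linear forms, call two terms \<open>K\<close>-equivalent if every form outside \<open>K\<close> has, up
  to scalars, the same multiplicity in both. As long as a form of the circuit lies outside \<open>K\<close>,
  simplicity yields several classes. The terms of a class share their part outside \<open>K\<close>, up to
  scalars, so summing over the classes gives a relation \<open>\<Sum> B\<^sub>q G\<^sub>q = 0\<close> in which \<open>B\<^sub>q\<close> is a polynomial in
  forms of \<open>K\<close>, nonzero by minimality, and \<open>G\<^sub>q\<close> is a product of forms outside \<open>K\<close>.
  Substitutions that are the identity on \<open>K\<close> and eliminate one form at a time shorten this relation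
  until two inequivalent terms are matched: outside \<open>K\<close> their forms agree, with multiplicities and up
  to scalars, modulo the at most \<open>k\<close> eliminated forms.

  Now add the eliminated forms to \<open>K\<close>. For the matched pair this at least doubles the number of
  forms of unbalanced multiplicity in every class, modulo \<open>K\<close>, of such a form outside \<open>K\<close>. As there
  are only \<open>2 d\<close> forms in two terms, each of the at most \<open>k\<^sup>2\<close> pairs is matched at most
  \<open>2 + log\<^sub>2 d\<close> times, hence the forms of the circuit are spanned by \<open>k\<^sup>3 (2 + log\<^sub>2 d)\<close> forms.

  For the transfer of the constant, a circuit over an arbitrary field is the image of a circuit over a
  countable subfield, which has a copy on a set of natural numbers.
\<close>

section \<open>The polynomial ring\<close>

text \<open>Unique factorisation is never invoked. Forms are compared up to scalars by counting, and
  equal counts already make two products agree up to a scalar. Besides that, the core needs only a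
  domain in which eliminating one form extends to a ring endomorphism. These eliminations are linear
  projections, so the size of the field does not matter. The obstacle is that a matching holds only
  modulo the forms it eliminates: once these are added to \<open>K\<close>, the same pair may be
  inequivalent again. Progress is visible only in how crowded the classes are. A form that is still
  unbalanced outside the new span must have been compensated, under the substitution, by an
  unbalanced form from another class modulo the old span, and the two classes merge. This doubling
  is the source of the logarithm. The budget is kept per pair of terms: an excess of at least
  \<open>2 ^ r\<close> after \<open>r\<close> matchings can be at most \<open>2 * d\<close>, and one
  further matching may follow, hence the summand 2.\<close>

lemma finite_submultisets: "finite {M. M \<subseteq># (m :: 'b multiset)}"
proof (induction m)
  case empty
  then show ?case by simp
next
  case (add a m)
  have "{M. M \<subseteq># add_mset a m} \<subseteq> {M. M \<subseteq># m} \<union> add_mset a ` {M. M \<subseteq># m}"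
  proof
    fix M assume M: "M \<in> {M. M \<subseteq># add_mset a m}"
    show "M \<in> {M. M \<subseteq># m} \<union> add_mset a ` {M. M \<subseteq># m}"
    proof (cases "a \<in># M")
      case True
      then have "M = add_mset a (M - {#a#})" by simp
      moreover from this M have "M - {#a#} \<subseteq># m"
        by (metis mem_Collect_eq mset_subset_eq_add_mset_cancel)
      ultimately show ?thesis by blast
    next
      case False
      then show ?thesis using M
        by (simp add: subset_eq_diff_conv diff_single_trivial
            flip: subset_eq_diff_conv) (metis False diff_single_trivial subset_eq_diff_conv add_mset_add_single)
    qed
  qed
  then show ?case using add finite_subset by blast
qed

lemma diff_diff_mset: "M \<subseteq># m \<Longrightarrow> m - (m - M) = (M :: 'b multiset)"
  by (auto simp: mset_subset_eq_exists_conv)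

section \<open>Convolution of indexed polynomials\<close>

context ring
begin

definition conv :: "('c multiset \<Rightarrow> 'a) \<Rightarrow> ('c multiset \<Rightarrow> 'a) \<Rightarrow> 'c multiset \<Rightarrow> 'a" where
  "conv P Q = (\<lambda>m. \<Oplus>M\<in>{M. M \<subseteq># m}. P M \<otimes> Q (m - M))"

lemma carrier_coeffD [simp]: "carrier_coeff P \<Longrightarrow> P m \<in> carrier R"
  by (simp add: carrier_coeff_def)

lemma carrier_coeff_indexed_const [simp]: "k \<in> carrier R \<Longrightarrow> carrier_coeff (indexed_const k)"
  by (simp add: carrier_coeff_def indexed_const_def)

lemma carrier_coeff_conv [simp]:
  assumes "carrier_coeff P" "carrier_coeff Q"
  shows "carrier_coeff (conv P Q)"
  using assms by (auto simp: carrier_coeff_def conv_def intro!: finsum_closed)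

lemmas [simp] = indexed_padd_in_carrier indexed_pmult_in_carrier

lemma conv_padd_left:
  assumes "carrier_coeff P" "carrier_coeff P'" "carrier_coeff Q"
  shows "conv (P \<Oplus> P') Q = conv P Q \<Oplus> conv P' Q"
proof
  fix m
  have "conv (P \<Oplus> P') Q m = (\<Oplus>M\<in>{M. M \<subseteq># m}. P M \<otimes> Q (m - M) \<oplus> P' M \<otimes> Q (m - M))"
    unfolding conv_def indexed_padd_def
    by (rule add.finprod_cong') (use assms in \<open>auto simp: l_distr\<close>)
  also have "\<dots> = (conv P Q \<Oplus> conv P' Q) m"
    unfolding conv_def indexed_padd_def
    by (rule add.finprod_multf) (use assms in auto)
  finally show "conv (P \<Oplus> P') Q m = (conv P Q \<Oplus> conv P' Q) m" .
qed

lemma conv_const_left: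
  assumes "k \<in> carrier R" "carrier_coeff Q"
  shows "conv (indexed_const k) Q = (\<lambda>m. k \<otimes> Q m)"
proof
  fix m
  have "conv (indexed_const k) Q m =
      (\<Oplus>M\<in>{M. M \<subseteq># m}. if {#} = M then (\<lambda>M. k \<otimes> Q (m - M)) M else \<zero>)"
    unfolding conv_def indexed_const_def
    by (rule add.finprod_cong') (use assms in auto)
  also have "\<dots> = k \<otimes> Q (m - {#})"
    by (rule add.finprod_singleton) (use assms finite_submultisets in auto)
  finally show "conv (indexed_const k) Q m = k \<otimes> Q m" by simp
qed

text \<open>Together with \<open>conv_padd_left\<close> and \<open>conv_const_left\<close> this
  gives one rule per constructor of \<open>indexed_pset\<close>. Closure, associativity and the
  multiplicativity of evaluation then follow by induction on the left factor, without reindexing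
  double sums. Here only submultisets containing \<open>i\<close> contribute, and removing one
  \<open>i\<close> turns them into the submultisets of \<open>m - {#i#}\<close>.\<close>

lemma conv_pmult_left:
  assumes "carrier_coeff P" "carrier_coeff Q"
  shows "conv (P \<Otimes> i) Q = conv P Q \<Otimes> i"
proof
  fix m
  show "conv (P \<Otimes> i) Q m = (conv P Q \<Otimes> i) m"
  proof (cases "i \<in># m")
    case False
    then have "i \<notin># M" if "M \<subseteq># m" for M using that mset_subset_eqD by metis
    then have "conv (P \<Otimes> i) Q m = (\<Oplus>M\<in>{M. M \<subseteq># m}. \<zero>)"
      unfolding conv_def indexed_pmult_def
      by (intro add.finprod_cong') (use assms in auto)
    then show ?thesis using False by (simp add: indexed_pmult_def)
  next
    case True
    define m' where "m' = m - {#i#}"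
    have m: "m = add_mset i m'" using True by (simp add: m'_def)
    have inj: "inj_on (add_mset i) {M. M \<subseteq># m'}" by (auto simp: inj_on_def)
    have "conv (P \<Otimes> i) Q m = (\<Oplus>M\<in>add_mset i ` {M. M \<subseteq># m'}. (P \<Otimes> i) M \<otimes> Q (m - M))"
      unfolding conv_def
    proof (rule add.finprod_mono_neutral_cong_right)
      show "add_mset i ` {M. M \<subseteq># m'} \<subseteq> {M. M \<subseteq># m}" by (auto simp: m)
      fix M assume M: "M \<in> {M. M \<subseteq># m} - add_mset i ` {M. M \<subseteq># m'}"
      have "i \<notin># M"
      proof
        assume "i \<in># M"
        then have "M = add_mset i (M - {#i#})" by simp
        moreover from this M have "M - {#i#} \<subseteq># m'"
          by (metis Diff_iff m mem_Collect_eq mset_subset_eq_add_mset_cancel)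
        ultimately show False using M by blast
      qed
      then show "(P \<Otimes> i) M \<otimes> Q (m - M) = \<zero>" using assms by (simp add: indexed_pmult_def)
    qed (use assms finite_submultisets in auto)
    also have "\<dots> = (\<Oplus>M\<in>{M. M \<subseteq># m'}. (P \<Otimes> i) (add_mset i M) \<otimes> Q (m - add_mset i M))"
      by (rule add.finprod_reindex) (use assms inj in auto)
    also have "\<dots> = conv P Q m'"
      unfolding conv_def
      by (rule add.finprod_cong') (use assms in \<open>auto simp: indexed_pmult_def m\<close>)
    also have "\<dots> = (conv P Q \<Otimes> i) m"
      using True by (simp add: indexed_pmult_def m'_def)
    finally show ?thesis .
  qed
qed

lemma indexed_pset_carrier_coeff [simp]:
  "P \<in> indexed_pset I (carrier R) \<Longrightarrow> carrier_coeff P"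
  using indexed_pset_in_carrier by blast

lemma scale_padd:
  assumes "k \<in> carrier R" "carrier_coeff P" "carrier_coeff Q"
  shows "(\<lambda>m. k \<otimes> (P \<Oplus> Q) m) = (\<lambda>m. k \<otimes> P m) \<Oplus> (\<lambda>m. k \<otimes> Q m)"
  using assms by (auto simp: indexed_padd_def r_distr)

lemma scale_pmult:
  assumes "k \<in> carrier R"
  shows "(\<lambda>m. k \<otimes> (P \<Otimes> i) m) = (\<lambda>m. k \<otimes> P m) \<Otimes> i"
  using assms by (auto simp: indexed_pmult_def)

lemma scale_in_pset:
  assumes "Q \<in> indexed_pset I (carrier R)" "k \<in> carrier R"
  shows "(\<lambda>m. k \<otimes> Q m) \<in> indexed_pset I (carrier R)"
  using assms
proof (induction)
  case (indexed_const k')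
  have "(\<lambda>m. k \<otimes> indexed_const k' m) = indexed_const (k \<otimes> k')"
    using indexed_const by (auto simp: indexed_const_def)
  then show ?case using indexed_const by (metis indexed_pset.indexed_const m_closed)
next
  case (indexed_padd P Q)
  then show ?case by (simp add: scale_padd indexed_pset.indexed_padd)
next
  case (indexed_pmult P i)
  then show ?case by (simp add: scale_pmult indexed_pset.indexed_pmult)
qed

lemma conv_in_pset:
  assumes "P \<in> indexed_pset I (carrier R)" "Q \<in> indexed_pset I (carrier R)"
  shows "conv P Q \<in> indexed_pset I (carrier R)"
  using assms
  by (induction) (simp_all add: conv_const_left scale_in_pset conv_padd_left conv_pmult_left
      indexed_pset.indexed_padd indexed_pset.indexed_pmult)

lemma conv_scale_left:
  assumes "k \<in> carrier R" "carrier_coeff Q" "carrier_coeff S"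
  shows "conv (\<lambda>m. k \<otimes> Q m) S = (\<lambda>m. k \<otimes> conv Q S m)"
proof
  fix m
  have "(\<Oplus>M\<in>{M. M \<subseteq># m}. k \<otimes> Q M \<otimes> S (m - M)) =
      (\<Oplus>M\<in>{M. M \<subseteq># m}. k \<otimes> (Q M \<otimes> S (m - M)))"
    by (rule add.finprod_cong') (use assms in \<open>auto simp: m_assoc\<close>)
  then show "conv (\<lambda>m. k \<otimes> Q m) S m = k \<otimes> conv Q S m"
    unfolding conv_def using assms by (simp add: finsum_rdistr finite_submultisets)
qed

lemma conv_assoc:
  assumes "P \<in> indexed_pset I (carrier R)" "Q \<in> indexed_pset I (carrier R)"
    "S \<in> indexed_pset I (carrier R)"
  shows "conv (conv P Q) S = conv P (conv Q S)"
  using assms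
proof (induction)
  case (indexed_const k)
  then show ?case by (simp add: conv_const_left conv_scale_left)
next
  case (indexed_padd P P')
  then show ?case by (simp add: conv_padd_left)
next
  case (indexed_pmult P i)
  then show ?case by (simp add: conv_pmult_left)
qed

lemma pset_finite_support:
  assumes "P \<in> indexed_pset I (carrier R)"
  shows "finite {m. P m \<noteq> \<zero>}" "\<And>m. P m \<noteq> \<zero> \<Longrightarrow> set_mset m \<subseteq> I"
proof -
  have "finite {m. P m \<noteq> \<zero>} \<and> (\<forall>m. P m \<noteq> \<zero> \<longrightarrow> set_mset m \<subseteq> I)"
    using assms
  proof (induction)
    case (indexed_const k)
    have "{m. indexed_const k m \<noteq> \<zero>} \<subseteq> {{#}}" by (auto simp: indexed_const_def)
    then show ?case using finite_subset by (auto simp: indexed_const_def)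
  next
    case (indexed_padd P Q)
    then have "{m. (P \<Oplus> Q) m \<noteq> \<zero>} \<subseteq> {m. P m \<noteq> \<zero>} \<union> {m. Q m \<noteq> \<zero>}"
      by (auto simp: indexed_padd_def)
    moreover have "(P \<Oplus> Q) m \<noteq> \<zero> \<Longrightarrow> P m \<noteq> \<zero> \<or> Q m \<noteq> \<zero>" for m
      by (auto simp: indexed_padd_def)
    ultimately show ?case using indexed_padd finite_subset
      by (metis (no_types, lifting) finite_UnI)
  next
    case (indexed_pmult P i)
    have *: "m \<in> add_mset i ` {m. P m \<noteq> \<zero>}" if "(P \<Otimes> i) m \<noteq> \<zero>" for m
    proof -
      have "i \<in># m" "P (m - {#i#}) \<noteq> \<zero>" using that by (auto simp: indexed_pmult_def split: if_splits)
      then show ?thesis by (intro image_eqI[of _ _ "m - {#i#}"]) auto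
    qed
    then have "{m. (P \<Otimes> i) m \<noteq> \<zero>} \<subseteq> add_mset i ` {m. P m \<noteq> \<zero>}" by blast
    then have "finite {m. (P \<Otimes> i) m \<noteq> \<zero>}"
      using indexed_pmult.IH finite_subset by (metis (no_types, lifting) finite_imageI)
    moreover have "set_mset m \<subseteq> I" if "(P \<Otimes> i) m \<noteq> \<zero>" for m
      using *[OF that] indexed_pmult by fastforce
    ultimately show ?case by blast
  qed
  then show "finite {m. P m \<noteq> \<zero>}" "\<And>m. P m \<noteq> \<zero> \<Longrightarrow> set_mset m \<subseteq> I" by blast+
qed

lemma uminus_in_pset:
  assumes "P \<in> indexed_pset I (carrier R)"
  shows "\<exists>Q\<in>indexed_pset I (carrier R). P \<Oplus> Q = indexed_const \<zero> \<and> Q \<Oplus> P = indexed_const \<zero>"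
proof -
  have "(\<lambda>m. (\<ominus> \<one>) \<otimes> P m) \<in> indexed_pset I (carrier R)"
    using assms by (simp add: scale_in_pset)
  moreover have "P \<Oplus> (\<lambda>m. (\<ominus> \<one>) \<otimes> P m) = indexed_const \<zero>"
    "(\<lambda>m. (\<ominus> \<one>) \<otimes> P m) \<Oplus> P = indexed_const \<zero>"
    using assms by (auto simp: indexed_padd_def indexed_const_def l_minus r_neg l_neg)
  ultimately show ?thesis by blast
qed

lemma mpoly_ring_simps [simp]:
  "carrier (mpoly_ring R n) = indexed_pset {..<n} (carrier R)"
  "monoid.mult (mpoly_ring R n) = conv"
  "monoid.one (mpoly_ring R n) = indexed_const \<one>"
  "ring.zero (mpoly_ring R n) = indexed_const \<zero>"
  "ring.add (mpoly_ring R n) = indexed_padd"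
  by (simp_all add: mpoly_ring_def conv_def fun_eq_iff)

end

section \<open>Commutativity and evaluation of polynomials\<close>

context cring
begin

text \<open>Taking complements in \<open>m\<close> is an involution on the submultisets of
  \<open>m\<close>, and it swaps the roles of the two factors in each summand.\<close>

lemma conv_commute:
  fixes P Q :: "'c multiset \<Rightarrow> 'a"
  assumes "carrier_coeff P" "carrier_coeff Q"
  shows "conv P Q = conv Q P"
proof
  fix m :: "'c multiset"
  have inj: "inj_on (\<lambda>M. m - M) {M. M \<subseteq># m}"
    by (rule inj_on_inverseI[of _ "\<lambda>M. m - M"]) (simp add: diff_diff_mset)
  have img: "(\<lambda>M. m - M) ` {M. M \<subseteq># m} = {M. M \<subseteq># m}"
  proof (intro equalityI subsetI)
    fix M assume "M \<in> {M. M \<subseteq># m}"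
    then show "M \<in> (\<lambda>M. m - M) ` {M. M \<subseteq># m}"
      by (intro image_eqI[of _ _ "m - M"]) (auto simp: diff_diff_mset)
  qed auto
  have "conv P Q m = (\<Oplus>M\<in>(\<lambda>M. m - M) ` {M. M \<subseteq># m}. P M \<otimes> Q (m - M))"
    by (simp add: conv_def img)
  also have "\<dots> = (\<Oplus>M\<in>{M. M \<subseteq># m}. P (m - M) \<otimes> Q (m - (m - M)))"
    by (rule add.finprod_reindex) (use assms inj in auto)
  also have "\<dots> = conv Q P m"
    unfolding conv_def
    by (rule add.finprod_cong') (use assms in \<open>auto simp: m_comm diff_diff_mset\<close>)
  finally show "conv P Q m = conv Q P m" .
qed

lemma cring_mpoly_ring: "cring (mpoly_ring R n)"
proof (rule cringI)
  show "abelian_group (mpoly_ring R n)"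
  proof (rule abelian_groupI; simp)
    show "\<And>P Q. P \<in> indexed_pset {..<n} (carrier R) \<Longrightarrow> Q \<in> indexed_pset {..<n} (carrier R)
        \<Longrightarrow> P \<Oplus> Q \<in> indexed_pset {..<n} (carrier R)"
      by (rule indexed_pset.indexed_padd)
    show "indexed_const \<zero> \<in> indexed_pset {..<n} (carrier R)"
      by (simp add: indexed_pset.indexed_const)
    fix P assume P: "P \<in> indexed_pset {..<n} (carrier R)"
    then show "indexed_const \<zero> \<Oplus> P = P" by (simp add: indexed_padd_zero)
    show "\<exists>Q\<in>indexed_pset {..<n} (carrier R). Q \<Oplus> P = indexed_const \<zero>"
      using uminus_in_pset[OF P] by blast
    show "\<And>P Q. P \<in> indexed_pset {..<n} (carrier R) \<Longrightarrow> Q \<in> indexed_pset {..<n} (carrier R)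
        \<Longrightarrow> P \<Oplus> Q = Q \<Oplus> P"
      by (auto simp: indexed_padd_def a_comm)
  qed (auto simp: indexed_padd_def a_assoc)
  show "comm_monoid (mpoly_ring R n)"
  proof (rule comm_monoidI; simp)
    show "\<And>P Q. P \<in> indexed_pset {..<n} (carrier R) \<Longrightarrow> Q \<in> indexed_pset {..<n} (carrier R)
        \<Longrightarrow> conv P Q \<in> indexed_pset {..<n} (carrier R)"
      by (rule conv_in_pset)
    show "indexed_const \<one> \<in> indexed_pset {..<n} (carrier R)"
      by (simp add: indexed_pset.indexed_const)
    show "\<And>P. P \<in> indexed_pset {..<n} (carrier R) \<Longrightarrow> conv (indexed_const \<one>) P = P"
      by (simp add: conv_const_left)
    show "\<And>P Q S. P \<in> indexed_pset {..<n} (carrier R) \<Longrightarrow> Q \<in> indexed_pset {..<n} (carrier R) \<Longrightarrow>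
        S \<in> indexed_pset {..<n} (carrier R) \<Longrightarrow> conv (conv P Q) S = conv P (conv Q S)"
      by (rule conv_assoc)
    show "\<And>P Q. P \<in> indexed_pset {..<n} (carrier R) \<Longrightarrow> Q \<in> indexed_pset {..<n} (carrier R) \<Longrightarrow>
        conv P Q = conv Q P"
      by (rule conv_commute) simp_all
  qed
  show "\<And>P Q S. P \<in> carrier (mpoly_ring R n) \<Longrightarrow> Q \<in> carrier (mpoly_ring R n) \<Longrightarrow>
      S \<in> carrier (mpoly_ring R n) \<Longrightarrow>
      (P \<oplus>\<^bsub>mpoly_ring R n\<^esub> Q) \<otimes>\<^bsub>mpoly_ring R n\<^esub> S =
        P \<otimes>\<^bsub>mpoly_ring R n\<^esub> S \<oplus>\<^bsub>mpoly_ring R n\<^esub> Q \<otimes>\<^bsub>mpoly_ring R n\<^esub> S"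
    by (simp add: conv_padd_left)
qed

text \<open>The universal property of the polynomial ring. It is applied with the polynomial ring
  itself as target, where it turns a choice of images of the variables into a substitution.\<close>

lemma mpoly_evaluation:
  assumes S: "cring S" and h: "h \<in> ring_hom R S" and s: "\<And>i. i < n \<Longrightarrow> s i \<in> carrier S"
  shows "\<exists>\<sigma>\<in>ring_hom (mpoly_ring R n) S.
    (\<forall>k\<in>carrier R. \<sigma> (indexed_const k) = h k) \<and> (\<forall>i<n. \<sigma> (indexed_var i) = s i)"
proof -
  interpret S: cring S by fact
  interpret h: ring_hom_cring R S h
    by (unfold_locales) (use h in auto)
  define mon where "mon m = (\<Otimes>\<^bsub>S\<^esub>i\<in>{..<n}. s i [^]\<^bsub>S\<^esub> count m i)" for m
  define \<sigma> where "\<sigma> P = (\<Oplus>\<^bsub>S\<^esub>m\<in>{m. P m \<noteq> \<zero>}. h (P m) \<otimes>\<^bsub>S\<^esub> mon m)" for P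
  let ?P = "indexed_pset {..<n} (carrier R)"
  have mon_closed [simp]: "mon m \<in> carrier S" for m
    unfolding mon_def using s by (intro S.finprod_closed) auto
  have mon_empty: "mon {#} = \<one>\<^bsub>S\<^esub>" by (simp add: mon_def)
  have mon_add: "mon (add_mset i m) = mon m \<otimes>\<^bsub>S\<^esub> s i" if i: "i < n" for i m
  proof -
    have "mon (add_mset i m) =
        (\<Otimes>\<^bsub>S\<^esub>j\<in>{..<n}. s j [^]\<^bsub>S\<^esub> count m j \<otimes>\<^bsub>S\<^esub> (if i = j then s j else \<one>\<^bsub>S\<^esub>))"
      unfolding mon_def by (rule S.finprod_cong') (use s in auto)
    also have "\<dots> = mon m \<otimes>\<^bsub>S\<^esub> (\<Otimes>\<^bsub>S\<^esub>j\<in>{..<n}. if i = j then s j else \<one>\<^bsub>S\<^esub>)"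
      unfolding mon_def by (rule S.finprod_multf) (use s in auto)
    also have "(\<Otimes>\<^bsub>S\<^esub>j\<in>{..<n}. if i = j then s j else \<one>\<^bsub>S\<^esub>) = s i"
      by (rule S.finprod_singleton) (use s i in auto)
    finally show ?thesis .
  qed
  \<comment> \<open>Supports change under addition and multiplication, so sums are compared over a
    common finite set of monomials that contains them.\<close>
  have \<sigma>_superset: "\<sigma> P = (\<Oplus>\<^bsub>S\<^esub>m\<in>A. h (P m) \<otimes>\<^bsub>S\<^esub> mon m)"
    if "P \<in> ?P" "finite A" "{m. P m \<noteq> \<zero>} \<subseteq> A" for P A
    unfolding \<sigma>_def
    by (rule S.add.finprod_mono_neutral_cong_left) (use that in auto)
  have \<sigma>_closed [simp]: "\<sigma> P \<in> carrier S" if "P \<in> ?P" for P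
    unfolding \<sigma>_def using that by (intro S.finsum_closed) auto
  have \<sigma>_add: "\<sigma> (P \<Oplus> Q) = \<sigma> P \<oplus>\<^bsub>S\<^esub> \<sigma> Q" if P: "P \<in> ?P" and Q: "Q \<in> ?P" for P Q
  proof -
    define A where "A = {m. P m \<noteq> \<zero>} \<union> {m. Q m \<noteq> \<zero>}"
    have A: "finite A" using pset_finite_support(1)[OF P] pset_finite_support(1)[OF Q]
      by (simp add: A_def)
    have PQ: "P \<Oplus> Q \<in> ?P" using P Q by (rule indexed_pset.indexed_padd)
    have "\<sigma> (P \<Oplus> Q) = (\<Oplus>\<^bsub>S\<^esub>m\<in>A. h ((P \<Oplus> Q) m) \<otimes>\<^bsub>S\<^esub> mon m)"
      by (rule \<sigma>_superset[OF PQ A]) (auto simp: A_def indexed_padd_def)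
    also have "\<dots> = (\<Oplus>\<^bsub>S\<^esub>m\<in>A. h (P m) \<otimes>\<^bsub>S\<^esub> mon m \<oplus>\<^bsub>S\<^esub> h (Q m) \<otimes>\<^bsub>S\<^esub> mon m)"
      by (rule S.add.finprod_cong') (use P Q in \<open>auto simp: indexed_padd_def S.l_distr\<close>)
    also have "\<dots> = (\<Oplus>\<^bsub>S\<^esub>m\<in>A. h (P m) \<otimes>\<^bsub>S\<^esub> mon m) \<oplus>\<^bsub>S\<^esub> (\<Oplus>\<^bsub>S\<^esub>m\<in>A. h (Q m) \<otimes>\<^bsub>S\<^esub> mon m)"
      by (rule S.add.finprod_multf) (use P Q in auto)
    also have "\<dots> = \<sigma> P \<oplus>\<^bsub>S\<^esub> \<sigma> Q"
      using \<sigma>_superset[OF P A] \<sigma>_superset[OF Q A] by (simp add: A_def)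
    finally show ?thesis .
  qed
  have \<sigma>_scale: "\<sigma> (\<lambda>m. k \<otimes> Q m) = h k \<otimes>\<^bsub>S\<^esub> \<sigma> Q" if k: "k \<in> carrier R" and Q: "Q \<in> ?P" for k Q
  proof -
    note A = pset_finite_support(1)[OF Q]
    have kQ: "(\<lambda>m. k \<otimes> Q m) \<in> ?P" using Q k by (rule scale_in_pset)
    have "\<sigma> (\<lambda>m. k \<otimes> Q m) = (\<Oplus>\<^bsub>S\<^esub>m\<in>{m. Q m \<noteq> \<zero>}. h (k \<otimes> Q m) \<otimes>\<^bsub>S\<^esub> mon m)"
      by (rule \<sigma>_superset[OF kQ A]) (use k in auto)
    also have "\<dots> = (\<Oplus>\<^bsub>S\<^esub>m\<in>{m. Q m \<noteq> \<zero>}. h k \<otimes>\<^bsub>S\<^esub> (h (Q m) \<otimes>\<^bsub>S\<^esub> mon m))"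
      by (rule S.add.finprod_cong') (use k Q in \<open>auto simp: S.m_assoc\<close>)
    also have "\<dots> = h k \<otimes>\<^bsub>S\<^esub> \<sigma> Q"
      unfolding \<sigma>_def by (rule S.finsum_rdistr[symmetric]) (use A k Q in auto)
    finally show ?thesis .
  qed
  have \<sigma>_pmult: "\<sigma> (P \<Otimes> i) = \<sigma> P \<otimes>\<^bsub>S\<^esub> s i" if P: "P \<in> ?P" and i: "i < n" for P i
  proof -
    note fin = pset_finite_support(1)[OF P]
    have Pi: "P \<Otimes> i \<in> ?P" using P i by (intro indexed_pset.indexed_pmult) auto
    have "\<sigma> (P \<Otimes> i) = (\<Oplus>\<^bsub>S\<^esub>m\<in>add_mset i ` {m. P m \<noteq> \<zero>}. h ((P \<Otimes> i) m) \<otimes>\<^bsub>S\<^esub> mon m)"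
    proof (rule \<sigma>_superset[OF Pi])
      show "{m. (P \<Otimes> i) m \<noteq> \<zero>} \<subseteq> add_mset i ` {m. P m \<noteq> \<zero>}"
      proof
        fix m assume "m \<in> {m. (P \<Otimes> i) m \<noteq> \<zero>}"
        then have "i \<in># m" "P (m - {#i#}) \<noteq> \<zero>" by (auto simp: indexed_pmult_def split: if_splits)
        then show "m \<in> add_mset i ` {m. P m \<noteq> \<zero>}" by (intro image_eqI[of _ _ "m - {#i#}"]) auto
      qed
    qed (use fin in simp)
    also have "\<dots> = (\<Oplus>\<^bsub>S\<^esub>m\<in>{m. P m \<noteq> \<zero>}. h ((P \<Otimes> i) (add_mset i m)) \<otimes>\<^bsub>S\<^esub> mon (add_mset i m))"
      by (rule S.add.finprod_reindex) (use Pi in \<open>auto simp: inj_on_def\<close>)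
    also have "\<dots> = (\<Oplus>\<^bsub>S\<^esub>m\<in>{m. P m \<noteq> \<zero>}. h (P m) \<otimes>\<^bsub>S\<^esub> mon m \<otimes>\<^bsub>S\<^esub> s i)"
      by (rule S.add.finprod_cong')
        (use P s i in \<open>auto simp: indexed_pmult_def mon_add S.m_assoc\<close>)
    also have "\<dots> = \<sigma> P \<otimes>\<^bsub>S\<^esub> s i"
      unfolding \<sigma>_def by (rule S.finsum_ldistr[symmetric]) (use fin P s i in auto)
    finally show ?thesis .
  qed
  have \<sigma>_const: "\<sigma> (indexed_const k) = h k" if k: "k \<in> carrier R" for k
  proof -
    have "\<sigma> (indexed_const k) = (\<Oplus>\<^bsub>S\<^esub>m\<in>{{#}}. h (indexed_const k m) \<otimes>\<^bsub>S\<^esub> mon m)"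
      by (rule \<sigma>_superset[OF indexed_pset.indexed_const[OF k]]) (auto simp: indexed_const_def)
    then show ?thesis using k by (simp add: indexed_const_def mon_empty)
  qed
  have \<sigma>_var: "\<sigma> (indexed_var i) = s i" if "i < n" for i
    unfolding indexed_var_def using that s
    by (simp add: \<sigma>_pmult \<sigma>_const indexed_pset.indexed_const)
  have \<sigma>_mult: "\<sigma> (conv P Q) = \<sigma> P \<otimes>\<^bsub>S\<^esub> \<sigma> Q" if P: "P \<in> ?P" and Q: "Q \<in> ?P" for P Q
    using P
  proof (induction)
    case (indexed_const k)
    then show ?case using Q by (simp add: conv_const_left \<sigma>_scale \<sigma>_const)
  next
    case (indexed_padd P P')
    then show ?case using Q by (simp add: conv_padd_left \<sigma>_add conv_in_pset S.l_distr)
  next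
    case (indexed_pmult P i)
    then show ?case using Q s by (simp add: conv_pmult_left \<sigma>_pmult conv_in_pset S.m_ac)
  qed
  have "\<sigma> \<in> ring_hom (mpoly_ring R n) S"
    by (rule ring_hom_memI) (simp_all add: \<sigma>_mult \<sigma>_add \<sigma>_const)
  then show ?thesis using \<sigma>_const \<sigma>_var by blast
qed

end

section \<open>Absence of zero divisors\<close>

context domain
begin

text \<open>Leading monomials in the multiset order, which is linear and compatible with addition.
  In the coefficient at \<open>p + q\<close>, a divisor \<open>M\<close> other than \<open>p\<close>
  could contribute only if \<open>M < p\<close> and its complement were at most \<open>q\<close>,
  but then the two would add up to less than \<open>p + q\<close>.\<close>

lemma conv_nonzero:
  fixes P Q :: "('c :: linorder) multiset \<Rightarrow> 'a"
  assumes P: "P \<in> indexed_pset I (carrier R)" "P \<noteq> indexed_const \<zero>"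
    and Q: "Q \<in> indexed_pset I (carrier R)" "Q \<noteq> indexed_const \<zero>"
  shows "conv P Q \<noteq> indexed_const \<zero>"
proof -
  define p q where "p = Max {m. P m \<noteq> \<zero>}" and "q = Max {m. Q m \<noteq> \<zero>}"
  note fin = pset_finite_support(1)[OF P(1)] pset_finite_support(1)[OF Q(1)]
  have ne: "{m. P m \<noteq> \<zero>} \<noteq> {}" "{m. Q m \<noteq> \<zero>} \<noteq> {}"
    using P(2) Q(2) by (auto simp: indexed_zero_def)
  have p: "P p \<noteq> \<zero>" and q: "Q q \<noteq> \<zero>"
    using Max_in[OF fin(1) ne(1)] Max_in[OF fin(2) ne(2)] by (auto simp: p_def q_def)
  have ple: "m \<le> p" if "P m \<noteq> \<zero>" for m using that fin(1) by (auto simp: p_def)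
  have qle: "m \<le> q" if "Q m \<noteq> \<zero>" for m using that fin(2) by (auto simp: q_def)
  have zero: "P M \<otimes> Q (p + q - M) = \<zero>" if M: "M \<subseteq># p + q" "p \<noteq> M" for M
  proof (rule ccontr)
    assume "P M \<otimes> Q (p + q - M) \<noteq> \<zero>"
    then have "P M \<noteq> \<zero>" "Q (p + q - M) \<noteq> \<zero>" using P Q by auto
    then have "M < p" "p + q - M \<le> q" using ple qle M by (auto simp: order_less_le)
    then have "M + (p + q - M) < p + q" by (rule add_less_le_mono)
    then show False using M by simp
  qed
  have "conv P Q (p + q) =
      (\<Oplus>M\<in>{M. M \<subseteq># p + q}. if p = M then (\<lambda>M. P M \<otimes> Q (p + q - M)) M else \<zero>)"
    unfolding conv_def by (rule add.finprod_cong') (use P Q zero in auto)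
  also have "\<dots> = P p \<otimes> Q (p + q - p)"
    by (rule add.finprod_singleton) (use P Q finite_submultisets in auto)
  finally have "conv P Q (p + q) \<noteq> \<zero>"
    using p q P Q integral[of "P p" "Q q"] by auto
  then show ?thesis by (auto simp: indexed_zero_def)
qed

lemma domain_mpoly_ring: "domain (mpoly_ring R n)"
proof -
  interpret M: cring "mpoly_ring R n" by (rule cring_mpoly_ring)
  show ?thesis
  proof
    show "\<one>\<^bsub>mpoly_ring R n\<^esub> \<noteq> \<zero>\<^bsub>mpoly_ring R n\<^esub>"
      by (auto simp: indexed_const_def fun_eq_iff)
    show "\<And>P Q. P \<otimes>\<^bsub>mpoly_ring R n\<^esub> Q = \<zero>\<^bsub>mpoly_ring R n\<^esub> \<Longrightarrow> P \<in> carrier (mpoly_ring R n) \<Longrightarrow>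
        Q \<in> carrier (mpoly_ring R n) \<Longrightarrow> P = \<zero>\<^bsub>mpoly_ring R n\<^esub> \<or> Q = \<zero>\<^bsub>mpoly_ring R n\<^esub>"
      using conv_nonzero by auto
  qed
qed

end

section \<open>Substitutions of linear forms\<close>

definition (in ring) linear_functional :: "'a set \<Rightarrow> 'a set \<Rightarrow> ('a \<Rightarrow> 'a) \<Rightarrow> bool" where
  "linear_functional K W f \<longleftrightarrow> f \<in> W \<rightarrow> K \<and> (\<forall>v\<in>W. \<forall>w\<in>W. f (v \<oplus> w) = f v \<oplus> f w) \<and>
    (\<forall>c\<in>K. \<forall>v\<in>W. f (c \<otimes> v) = c \<otimes> f v)"

text \<open>The interface between algebra and combinatorics: polynomials disappear, and a space
  \<open>W\<close> of forms inside a domain remains. \<open>functional\<close> makes it possible to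
  remove a form while fixing a given span, and \<open>substitution\<close> is what is left of the
  universal property of polynomials.\<close>

locale form_ring = domain R for R :: "('a, 'b) ring_scheme" (structure) +
  fixes k0 W :: "'a set"
  assumes k0: "subfield k0 R"
    and W_carrier: "W \<subseteq> carrier R"
    and W_zero [simp]: "\<zero> \<in> W"
    and W_add [simp]: "v \<in> W \<Longrightarrow> w \<in> W \<Longrightarrow> v \<oplus> w \<in> W"
    and W_smult [simp]: "c \<in> k0 \<Longrightarrow> v \<in> W \<Longrightarrow> c \<otimes> v \<in> W"
    and functional: "w \<in> W \<Longrightarrow> w \<noteq> \<zero> \<Longrightarrow> \<exists>f. linear_functional k0 W f \<and> f w \<noteq> \<zero>"
    and substitution: "linear_functional k0 W f \<Longrightarrow> w \<in> W \<Longrightarrow>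
      \<exists>\<sigma>\<in>ring_hom R R. (\<forall>c\<in>k0. \<sigma> c = c) \<and> (\<forall>v\<in>W. \<sigma> v = v \<ominus> f v \<otimes> w)"
begin

declare Span.simps [simp del]

lemma W_closed [simp]: "v \<in> W \<Longrightarrow> v \<in> carrier R"
  using W_carrier by blast

lemma k0_closed [simp]: "c \<in> k0 \<Longrightarrow> c \<in> carrier R"
  using subfieldE(3)[OF k0] by blast

lemma k0_ops [simp]:
  "\<zero> \<in> k0" "\<one> \<in> k0" "c \<in> k0 \<Longrightarrow> \<ominus> c \<in> k0"
  "c \<in> k0 \<Longrightarrow> d \<in> k0 \<Longrightarrow> c \<otimes> d \<in> k0" "c \<in> k0 \<Longrightarrow> d \<in> k0 \<Longrightarrow> c \<oplus> d \<in> k0"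
  using subring_props[OF k0] by auto

lemma k0_minus [simp]: "c \<in> k0 \<Longrightarrow> d \<in> k0 \<Longrightarrow> c \<ominus> d \<in> k0"
  by (simp add: a_minus_def)

lemma k0_inv: "c \<in> k0 - {\<zero>} \<Longrightarrow> \<exists>d\<in>k0 - {\<zero>}. d \<otimes> c = \<one> \<and> c \<otimes> d = \<one>"
  using subfield_m_inv[OF k0] by blast

lemma k0_units_mult [simp]: "c \<in> k0 - {\<zero>} \<Longrightarrow> d \<in> k0 - {\<zero>} \<Longrightarrow> c \<otimes> d \<in> k0 - {\<zero>}"
  using integral[of c d] by auto

lemma W_neg [simp]: "v \<in> W \<Longrightarrow> \<ominus> v \<in> W"
  using W_smult[of "\<ominus> \<one>" v] by (simp add: l_minus)

lemma W_minus [simp]: "v \<in> W \<Longrightarrow> w \<in> W \<Longrightarrow> v \<ominus> w \<in> W"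
  by (simp add: a_minus_def)

lemma list_W_carrier: "set Us \<subseteq> W \<Longrightarrow> set Us \<subseteq> carrier R"
  using W_carrier by blast

lemma Span_ops:
  assumes "set Us \<subseteq> W"
  shows "\<zero> \<in> Span k0 Us"
    "\<And>v w. v \<in> Span k0 Us \<Longrightarrow> w \<in> Span k0 Us \<Longrightarrow> v \<oplus> w \<in> Span k0 Us"
    "\<And>v w. v \<in> Span k0 Us \<Longrightarrow> w \<in> Span k0 Us \<Longrightarrow> v \<ominus> w \<in> Span k0 Us"
    "\<And>c v. c \<in> k0 \<Longrightarrow> v \<in> Span k0 Us \<Longrightarrow> c \<otimes> v \<in> Span k0 Us"
  using list_W_carrier[OF assms]
    Span_subgroup_props[OF k0 list_W_carrier[OF assms]] Span_smult_closed[OF k0 list_W_carrier[OF assms]]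
  by (auto simp: a_minus_def)

lemma Span_Cons_iff: "u \<in> Span k0 (a # Us) \<longleftrightarrow> (\<exists>c\<in>k0. \<exists>v\<in>Span k0 Us. u = c \<otimes> a \<oplus> v)"
  by (simp add: Span.simps line_extension_mem_iff)

lemma Span_Nil [simp]: "Span k0 [] = {\<zero>}"
  by (simp add: Span.simps)

lemma Span_subset_W: "set Us \<subseteq> W \<Longrightarrow> Span k0 Us \<subseteq> W"
proof (induction Us)
  case (Cons a Us)
  then show ?case using W_add W_smult by (auto simp: Span_Cons_iff subset_iff)
qed simp

lemma Span_append_iff:
  assumes "set Us \<subseteq> W" "set Vs \<subseteq> W"
  shows "u \<in> Span k0 (Us @ Vs) \<longleftrightarrow> (\<exists>x\<in>Span k0 Us. \<exists>y\<in>Span k0 Vs. u = x \<oplus> y)"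
  using Span_append_eq_set_add[OF k0 list_W_carrier[OF assms(1)] list_W_carrier[OF assms(2)]]
  by (simp add: set_add_def')

lemma functionalD:
  assumes "linear_functional k0 W f"
  shows "v \<in> W \<Longrightarrow> f v \<in> k0" "v \<in> W \<Longrightarrow> w \<in> W \<Longrightarrow> f (v \<oplus> w) = f v \<oplus> f w"
    "c \<in> k0 \<Longrightarrow> v \<in> W \<Longrightarrow> f (c \<otimes> v) = c \<otimes> f v"
  using assms by (auto simp: linear_functional_def)

lemma functional_minus:
  assumes "linear_functional k0 W f" "v \<in> W" "w \<in> W"
  shows "f (v \<ominus> w) = f v \<ominus> f w"
proof -
  have "f (v \<oplus> (\<ominus> \<one>) \<otimes> w) = f v \<oplus> (\<ominus> \<one>) \<otimes> f w"
    using functionalD[OF assms(1)] assms(2,3) by simp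
  then show ?thesis
    using functionalD(1)[OF assms(1)] assms(2,3) by (simp add: a_minus_def l_minus)
qed

text \<open>Separation by induction on the spanning list, without a basis of \<open>W\<close>: a
  functional for the smaller span is corrected so as to vanish at one more vector
  \<open>b\<close>.\<close>

lemma functional_vanishing_on_Span:
  assumes "set Us \<subseteq> W" "w \<in> W" "w \<notin> Span k0 Us"
  shows "\<exists>f. linear_functional k0 W f \<and> (\<forall>v\<in>Span k0 Us. f v = \<zero>) \<and> f w = \<one>"
  using assms
proof (induction Us arbitrary: w)
  case Nil
  then obtain f where f: "linear_functional k0 W f" "f w \<noteq> \<zero>" using functional[of w] by auto
  note D = functionalD[OF f(1)]
  obtain d where d: "d \<in> k0" "d \<otimes> f w = \<one>"
    using k0_inv[of "f w"] D(1)[of w] f(2) Nil by auto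
  have "f (\<zero> \<oplus> \<zero>) = f \<zero> \<oplus> f \<zero>" by (rule D(2)) auto
  then have f0: "f \<zero> = \<zero>" using D(1)[of \<zero>] by simp
  have "linear_functional k0 W (\<lambda>v. d \<otimes> f v)"
    unfolding linear_functional_def using D d by (auto simp: r_distr m_lcomm)
  then show ?case using d f0 by (intro exI[of _ "\<lambda>v. d \<otimes> f v"]) auto
next
  case (Cons b Us)
  then have b: "b \<in> W" and Us: "set Us \<subseteq> W" by auto
  show ?case
  proof (cases "b \<in> Span k0 Us")
    case True
    have sub: "Span k0 (b # Us) \<subseteq> Span k0 Us"
      using True Span_ops[OF Us] by (auto simp: Span_Cons_iff)
    have "w \<notin> Span k0 Us"
      using Cons.prems mono_Span[OF k0 list_W_carrier[OF Us] W_closed[OF b]] by auto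
    from Cons.IH[OF Us Cons.prems(2) this] sub show ?thesis by blast
  next
    case False
    obtain g where g: "linear_functional k0 W g" "\<forall>v\<in>Span k0 Us. g v = \<zero>" "g b = \<one>"
      using Cons.IH[OF Us b False] by auto
    note gD = functionalD[OF g(1)]
    \<comment> \<open>The projection of \<open>w\<close> along \<open>b\<close> into the kernel of
      \<open>g\<close>. It stays outside the smaller span, so the induction hypothesis yields
      \<open>h\<close>.\<close>
    define w' where "w' = w \<ominus> g w \<otimes> b"
    have w': "w' \<in> W" using Cons.prems b gD by (simp add: w'_def)
    have "w' \<notin> Span k0 Us"
    proof
      assume "w' \<in> Span k0 Us"
      moreover have "w = g w \<otimes> b \<oplus> w'"
        using Cons.prems b gD(1)[of w] unfolding w'_def
        by (simp add: a_minus_def a_lcomm r_neg)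
      ultimately have "w \<in> Span k0 (b # Us)"
        using gD(1)[OF Cons.prems(2)] by (auto simp: Span_Cons_iff)
      then show False using Cons.prems by simp
    qed
    from Cons.IH[OF Us w' this] obtain h where
      h: "linear_functional k0 W h" "\<forall>v\<in>Span k0 Us. h v = \<zero>" "h w' = \<one>" by auto
    note hD = functionalD[OF h(1)]
    \<comment> \<open>The multiple of \<open>g\<close> is chosen to make \<open>f b\<close> vanish,
      while \<open>f w\<close> becomes \<open>h w'\<close>, which is one.\<close>
    define f where "f v = h v \<ominus> h b \<otimes> g v" for v
    have lin: "linear_functional k0 W f"
      unfolding linear_functional_def
    proof (intro conjI ballI)
      show "f \<in> W \<rightarrow> k0" using gD hD b by (auto simp: f_def)
    next
      fix v w assume "v \<in> W" "w \<in> W"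
      moreover from this have "h v \<in> carrier R" "h w \<in> carrier R" "g v \<in> carrier R" "g w \<in> carrier R"
        "h b \<in> carrier R" using gD hD b by auto
      ultimately show "f (v \<oplus> w) = f v \<oplus> f w"
        using gD(2)[of v w] hD(2)[of v w] unfolding f_def by (simp, algebra)
    next
      fix c v assume "c \<in> k0" "v \<in> W"
      moreover from this have "h v \<in> carrier R" "g v \<in> carrier R" "c \<in> carrier R" "h b \<in> carrier R"
        using gD hD b by auto
      ultimately show "f (c \<otimes> v) = c \<otimes> f v"
        using gD(3)[of c v] hD(3)[of c v] unfolding f_def by (simp, algebra)
    qed
    have "f v = \<zero>" if v: "v \<in> Span k0 (b # Us)" for v
    proof -
      from v obtain c x where c: "c \<in> k0" "x \<in> Span k0 Us" "v = c \<otimes> b \<oplus> x"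
        by (auto simp: Span_Cons_iff)
      have x: "x \<in> W" using c Span_subset_W[OF Us] by auto
      have "h v = c \<otimes> h b" "g v = c"
        using c x b hD gD g h by auto
      then show "f v = \<zero>" using hD(1)[OF b] c by (simp add: f_def m_comm a_minus_def r_neg)
    qed
    moreover have "f w = \<one>"
    proof -
      have "h w \<ominus> g w \<otimes> h b = \<one>"
        using h(3) Cons.prems b functional_minus[OF h(1), of w "g w \<otimes> b"] gD(1)[of w] hD(3)[of "g w" b]
        by (simp add: w'_def)
      then show ?thesis using gD(1)[OF Cons.prems(2)] hD(1)[OF b] by (simp add: f_def m_comm)
    qed
    ultimately show ?thesis using lin by blast
  qed
qed

text \<open>Fixing \<open>k0\<close> and \<open>K\<close> makes such a map the identity on every
  polynomial in forms of \<open>K\<close>. The coefficients of the relation are of this kind and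
  have to survive all eliminations unchanged.\<close>

definition fixing_hom :: "'a set \<Rightarrow> ('a \<Rightarrow> 'a) \<Rightarrow> bool" where
  "fixing_hom K \<phi> \<longleftrightarrow> \<phi> \<in> ring_hom R R \<and> (\<forall>c\<in>k0. \<phi> c = c) \<and> \<phi> ` W \<subseteq> W \<and> (\<forall>v\<in>K. \<phi> v = v)"

text \<open>For a functional that vanishes on the span and is one at \<open>w\<close>, subtracting
  \<open>f v \<otimes> w\<close> is the projection along \<open>w\<close>. Hence no form other than
  the scalar multiples of \<open>w\<close> is killed.\<close>

lemma elimination:
  assumes Us: "set Us \<subseteq> W" and w: "w \<in> W" "w \<notin> Span k0 Us"
  shows "\<exists>\<sigma>. fixing_hom (Span k0 Us) \<sigma> \<and> (\<forall>v\<in>W. \<sigma> v = \<zero> \<longleftrightarrow> (\<exists>c\<in>k0. v = c \<otimes> w))"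
proof -
  obtain f where f: "linear_functional k0 W f" "\<forall>v\<in>Span k0 Us. f v = \<zero>" "f w = \<one>"
    using functional_vanishing_on_Span[OF assms] by blast
  note fD = functionalD[OF f(1)]
  obtain \<sigma> where \<sigma>: "\<sigma> \<in> ring_hom R R" "\<forall>c\<in>k0. \<sigma> c = c" "\<forall>v\<in>W. \<sigma> v = v \<ominus> f v \<otimes> w"
    using substitution[OF f(1) w(1)] by blast
  have "\<forall>v\<in>Span k0 Us. \<sigma> v = v"
    using \<sigma>(3) f(2) Span_subset_W[OF Us] w by (auto simp: a_minus_def subset_iff)
  moreover have "\<sigma> ` W \<subseteq> W" using \<sigma>(3) fD(1) w by auto
  moreover have "\<sigma> v = \<zero> \<longleftrightarrow> (\<exists>c\<in>k0. v = c \<otimes> w)" if v: "v \<in> W" for v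
  proof
    assume "\<sigma> v = \<zero>"
    then have "v = f v \<otimes> w" using \<sigma>(3) v w fD(1)[OF v] by simp
    then show "\<exists>c\<in>k0. v = c \<otimes> w" using fD(1)[OF v] by blast
  next
    assume "\<exists>c\<in>k0. v = c \<otimes> w"
    then obtain c where c: "c \<in> k0" "v = c \<otimes> w" by blast
    then have "f v = c" using fD(3)[OF c(1) w(1)] f(3) by simp
    then show "\<sigma> v = \<zero>" using \<sigma>(3) v c w by (simp add: a_minus_def r_neg)
  qed
  ultimately show ?thesis using \<sigma> unfolding fixing_hom_def by blast
qed

section \<open>Forms up to nonzero scalars\<close>

definition proportional :: "'a \<Rightarrow> 'a \<Rightarrow> bool" where
  "proportional v w \<longleftrightarrow> (\<exists>c\<in>k0 - {\<zero>}. v = c \<otimes> w)"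

lemma proportional_refl: "v \<in> W \<Longrightarrow> proportional v v"
  unfolding proportional_def by (intro bexI[of _ \<one>]) auto

lemma proportional_sym:
  assumes "proportional v w" "w \<in> W"
  shows "proportional w v"
proof -
  obtain c where c: "c \<in> k0 - {\<zero>}" "v = c \<otimes> w" using assms by (auto simp: proportional_def)
  then obtain d where d: "d \<in> k0 - {\<zero>}" "d \<otimes> c = \<one>" using k0_inv by blast
  then have "w = d \<otimes> v" using c assms by (simp flip: m_assoc)
  then show ?thesis using d by (auto simp: proportional_def)
qed

lemma proportional_trans:
  assumes "proportional u v" "proportional v w" "w \<in> W"
  shows "proportional u w"
proof -
  obtain c d where cd: "c \<in> k0 - {\<zero>}" "u = c \<otimes> v" "d \<in> k0 - {\<zero>}" "v = d \<otimes> w"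
    using assms by (auto simp: proportional_def)
  then have "u = (c \<otimes> d) \<otimes> w" using assms(3) by (simp add: m_assoc)
  then show ?thesis unfolding proportional_def using k0_units_mult[OF cd(1,3)] by blast
qed

lemma proportional_Span_iff:
  assumes "set Us \<subseteq> W" "proportional v w" "w \<in> W"
  shows "v \<in> Span k0 Us \<longleftrightarrow> w \<in> Span k0 Us"
proof -
  have "proportional w v" using assms proportional_sym by blast
  then show ?thesis using assms(2) Span_ops(4)[OF assms(1)]
    unfolding proportional_def by (metis DiffD1)
qed

text \<open>The substitute for unique factorisation: the indices of the two families are paired off
  one at a time within each proportionality class, and every pair contributes a scalar. The equality
  of cardinalities is what \<open>excess_doubling\<close> takes from it.\<close>

lemma proportional_families:
  assumes "finite A" "finite B" "f \<in> A \<rightarrow> W" "g \<in> B \<rightarrow> W"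
    and "\<And>u. u \<in> W \<Longrightarrow> card {j \<in> A. proportional (f j) u} = card {j \<in> B. proportional (g j) u}"
  shows "card A = card B \<and> (\<exists>c\<in>k0 - {\<zero>}. finprod R f A = c \<otimes> finprod R g B)"
  using assms
proof (induction A arbitrary: B rule: finite_induct)
  case empty
  have "B = {}"
  proof (rule ccontr)
    assume "B \<noteq> {}"
    then obtain j where j: "j \<in> B" by auto
    have "g j \<in> W" using empty j by auto
    moreover have "card {j' \<in> B. proportional (g j') (g j)} \<noteq> 0"
      using j empty proportional_refl \<open>g j \<in> W\<close> by (subst card_0_eq) auto
    ultimately show False using empty(4)[of "g j"] by simp
  qed
  then show ?case by (auto intro!: bexI[of _ \<one>])
next
  case (insert a A)
  have fa: "f a \<in> W" using insert by auto
  have "card {j \<in> insert a A. proportional (f j) (f a)} \<noteq> 0"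
    using insert fa proportional_refl by (subst card_0_eq) auto
  then have "card {j \<in> B. proportional (g j) (f a)} \<noteq> 0"
    using insert.prems(4)[OF fa] by simp
  then obtain b where b: "b \<in> B" "proportional (g b) (f a)"
    using card.empty by (metis (no_types, lifting) Collect_empty_eq)
  have gb: "g b \<in> W" using b insert by auto
  define B' where "B' = B - {b}"
  have B: "B = insert b B'" "b \<notin> B'" "finite B'" using b insert by (auto simp: B'_def)
  \<comment> \<open>\<open>a\<close> and its partner \<open>b\<close> carry forms of the same class,
    so removing both changes the two counts at \<open>u\<close> by the same amount.\<close>
  have eq: "card {j \<in> A. proportional (f j) u} = card {j \<in> B'. proportional (g j) u}" if u: "u \<in> W" for u
  proof -
    have iff: "proportional (f a) u \<longleftrightarrow> proportional (g b) u"
      using b fa gb u proportional_trans proportional_sym by metis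
    have "{j \<in> insert a A. proportional (f j) u} =
        (if proportional (f a) u then insert a {j \<in> A. proportional (f j) u} else {j \<in> A. proportional (f j) u})"
      "{j \<in> insert b B'. proportional (g j) u} =
        (if proportional (g b) u then insert b {j \<in> B'. proportional (g j) u} else {j \<in> B'. proportional (g j) u})"
      by auto
    then show ?thesis using insert.prems(4)[OF u] insert.hyps B iff
      by (auto split: if_splits)
  qed
  from insert.IH[OF B(3) _ _ eq] insert.prems B obtain c where
    c: "card A = card B'" "c \<in> k0 - {\<zero>}" "finprod R f A = c \<otimes> finprod R g B'" by auto
  obtain e where e: "e \<in> k0 - {\<zero>}" "f a = e \<otimes> g b"
    using proportional_sym[OF b(2) fa] by (auto simp: proportional_def)
  have A: "f \<in> A \<rightarrow> carrier R" "g \<in> B' \<rightarrow> carrier R"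
    using insert.prems(2,3) by (auto simp: B Pi_iff)
  have "finprod R f (insert a A) = f a \<otimes> finprod R f A"
    using insert A fa by simp
  also have "\<dots> = (e \<otimes> c) \<otimes> (g b \<otimes> finprod R g B')"
    using c e gb A finprod_closed[OF A(2)] by (simp add: m_ac)
  also have "g b \<otimes> finprod R g B' = finprod R g B"
    unfolding B using B A gb by simp
  finally show ?case
    using k0_units_mult[OF e(1) c(2)] c insert.hyps B by auto
qed

end

section \<open>Matchings\<close>

lemma (in domain) finprod_nonzero:
  "finite A \<Longrightarrow> f \<in> A \<rightarrow> carrier R - {\<zero>} \<Longrightarrow> finprod R f A \<in> carrier R - {\<zero>}"
proof (induction A rule: finite_induct)
  case (insert a A)
  have "f \<in> A \<rightarrow> carrier R" "f a \<in> carrier R" using insert by auto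
  moreover have "finprod R f A \<in> carrier R" "finprod R f A \<noteq> \<zero>" "f a \<noteq> \<zero>"
    using insert by auto
  ultimately show ?case using insert.hyps integral[of "f a" "finprod R f A"] by auto
qed simp

lemma (in domain) nat_pow_nonzero: "x \<in> carrier R \<Longrightarrow> x \<noteq> \<zero> \<Longrightarrow> x [^] (m :: nat) \<noteq> \<zero>"
proof (induction m)
  case (Suc m)
  then show ?case using integral[of "x [^] m" x] by auto
qed simp

context form_ring
begin

lemma fixing_hom_cring: "fixing_hom K \<phi> \<Longrightarrow> ring_hom_cring R R \<phi>"
  unfolding fixing_hom_def ring_hom_cring_def ring_hom_cring_axioms_def
  using is_cring by blast

lemma fixing_homD:
  assumes "fixing_hom K \<phi>"
  shows "v \<in> W \<Longrightarrow> \<phi> v \<in> W" "c \<in> k0 \<Longrightarrow> \<phi> c = c" "v \<in> K \<Longrightarrow> \<phi> v = v"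
    "c \<in> k0 \<Longrightarrow> v \<in> W \<Longrightarrow> \<phi> (c \<otimes> v) = c \<otimes> \<phi> v"
    "v \<in> W \<Longrightarrow> w \<in> W \<Longrightarrow> \<phi> (v \<oplus> w) = \<phi> v \<oplus> \<phi> w"
    "v \<in> W \<Longrightarrow> w \<in> W \<Longrightarrow> \<phi> (v \<ominus> w) = \<phi> v \<ominus> \<phi> w"
    "\<phi> \<zero> = \<zero>"
proof -
  interpret ring_hom_cring R R \<phi> using assms by (rule fixing_hom_cring)
  show "v \<in> W \<Longrightarrow> \<phi> v \<in> W" "c \<in> k0 \<Longrightarrow> \<phi> c = c" "v \<in> K \<Longrightarrow> \<phi> v = v"
    using assms by (auto simp: fixing_hom_def)
  then show "c \<in> k0 \<Longrightarrow> v \<in> W \<Longrightarrow> \<phi> (c \<otimes> v) = c \<otimes> \<phi> v"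
    "v \<in> W \<Longrightarrow> w \<in> W \<Longrightarrow> \<phi> (v \<oplus> w) = \<phi> v \<oplus> \<phi> w"
    "v \<in> W \<Longrightarrow> w \<in> W \<Longrightarrow> \<phi> (v \<ominus> w) = \<phi> v \<ominus> \<phi> w" "\<phi> \<zero> = \<zero>"
    using assms by (auto simp: fixing_hom_def a_minus_def)
qed

lemma fixing_hom_id: "fixing_hom K (\<lambda>v. v)"
  by (auto simp: fixing_hom_def intro: ring_hom_memI)

lemma fixing_hom_comp:
  assumes "fixing_hom K \<phi>" "fixing_hom K \<sigma>"
  shows "fixing_hom K (\<sigma> \<circ> \<phi>)"
  using assms ring_hom_trans[of \<phi> R R \<sigma> R] unfolding fixing_hom_def by (auto simp: image_subset_iff)

lemma proportional_zero: "proportional v w \<Longrightarrow> w \<in> W \<Longrightarrow> v = \<zero> \<longleftrightarrow> w = \<zero>"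
  unfolding proportional_def using integral[of _ w] by (metis DiffD1 DiffD2 W_closed k0_closed r_null singletonI)

text \<open>The constant family with value \<open>w\<close> has the same class counts as
  \<open>f\<close>, so \<open>proportional_families\<close> applies.\<close>

lemma finprod_proportional_const:
  assumes "finite A" "f \<in> A \<rightarrow> W" "w \<in> W" "\<And>j. j \<in> A \<Longrightarrow> proportional (f j) w"
  shows "\<exists>c\<in>k0 - {\<zero>}. finprod R f A = c \<otimes> w [^] card A"
proof -
  have iff: "proportional (f j) u \<longleftrightarrow> proportional w u" if "j \<in> A" "u \<in> W" for j u
    using assms that proportional_trans[of _ _ u] proportional_sym by (meson Pi_mem)
  have "card {j \<in> A. proportional (f j) u} = card {j \<in> A. proportional w u}" if "u \<in> W" for u
    using iff[OF _ that] by (intro arg_cong[of _ _ card]) auto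
  then have "\<exists>c\<in>k0 - {\<zero>}. finprod R f A = c \<otimes> finprod R (\<lambda>_. w) A"
    using proportional_families[OF assms(1,1,2), of "\<lambda>_. w"] assms(3) by blast
  then show ?thesis using finprod_const[of w A] assms(3) by simp
qed

end

section \<open>Matching two terms by successive eliminations\<close>

locale form_products = form_ring +
  fixes k d :: nat and l :: "nat \<Rightarrow> nat \<Rightarrow> 'a"
  assumes l_W [simp]: "i < k \<Longrightarrow> j < d \<Longrightarrow> l i j \<in> W"
begin

definition occurrences :: "('a \<Rightarrow> 'a) \<Rightarrow> nat \<Rightarrow> 'a \<Rightarrow> nat" where
  "occurrences \<phi> i u = card {j. j < d \<and> proportional (\<phi> (l i j)) u}"

definition matched :: "'a set \<Rightarrow> ('a \<Rightarrow> 'a) \<Rightarrow> nat \<Rightarrow> nat \<Rightarrow> bool" where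
  "matched K \<phi> a b \<longleftrightarrow> (\<forall>u\<in>W - K. occurrences \<phi> a u = occurrences \<phi> b u)"

text \<open>The factors still present in the relation: forms in \<open>K\<close> have gone into the
  coefficients, and forms killed by \<open>\<phi>\<close> were cancelled as part of a common power
  before being set to zero.\<close>

definition surviving :: "'a set \<Rightarrow> ('a \<Rightarrow> 'a) \<Rightarrow> nat \<Rightarrow> nat set" where
  "surviving K \<phi> i = {j. j < d \<and> l i j \<notin> K \<and> \<phi> (l i j) \<noteq> \<zero>}"

text \<open>
  If no two terms of the relation are matched, some \<open>w \<notin> K\<close> occurs with different multiplicities.
  After cancelling the least power of \<open>w\<close> that occurs, the substitution that eliminates \<open>w\<close> kills
  some of the terms, but not all, and leaves a relation of the same shape.
\<close>

lemma matching_of_relation: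
  assumes Us: "set Us \<subseteq> W" and K: "K = Span k0 Us"
    and "fixing_hom K \<phi>" "Q \<subseteq> {..<k}" "2 \<le> card Q"
    and "set L \<subseteq> W" "\<forall>v\<in>W. \<phi> v = \<zero> \<longrightarrow> v \<in> Span k0 L"
    and "\<forall>q\<in>Q. B q \<in> carrier R - {\<zero>} \<and> (\<forall>\<sigma>. fixing_hom K \<sigma> \<longrightarrow> \<sigma> (B q) = B q)"
    and "(\<Oplus>q\<in>Q. B q \<otimes> (\<Otimes>j\<in>surviving K \<phi> q. \<phi> (l q j))) = \<zero>"
  shows "\<exists>a\<in>Q. \<exists>b\<in>Q. a \<noteq> b \<and> (\<exists>\<phi>' L'. fixing_hom K \<phi>' \<and> set L' \<subseteq> W \<and>
    (\<forall>v\<in>W. \<phi>' v = \<zero> \<longrightarrow> v \<in> Span k0 L') \<and> length L' \<le> length L + card Q \<and> matched K \<phi>' a b)"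
  using assms(3-)
proof (induction "card Q" arbitrary: Q \<phi> L B rule: less_induct)
  case less
  note \<phi> = less.prems(1)
  interpret \<phi>: ring_hom_cring R R \<phi> using \<phi> by (rule fixing_hom_cring)
  note \<phi>D = fixing_homD[OF \<phi>]
  have fin: "finite Q" using less.prems(2) finite_subset by blast
  have l: "l q j \<in> W" if "q \<in> Q" "j < d" for q j using that less.prems(2) by auto
  show ?case
  proof (cases "\<exists>a\<in>Q. \<exists>b\<in>Q. a \<noteq> b \<and> matched K \<phi> a b")
    case True
    then show ?thesis using less.prems by (meson trans_le_add1 order_refl)
  next
    case False
    obtain a b where ab: "a \<in> Q" "b \<in> Q" "a \<noteq> b"
      using less.prems(3) by (metis card_le_Suc0_iff_eq fin not_less_eq_eq numeral_2_eq_2)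
    obtain w where w: "w \<in> W" "w \<notin> K" and neq: "occurrences \<phi> a w \<noteq> occurrences \<phi> b w"
      using False ab by (auto simp: matched_def)
    have w0: "w \<noteq> \<zero>" using w K Span_ops(1)[OF Us] by auto
    define n where "n q = occurrences \<phi> q w" for q
    \<comment> \<open>The terms that attain the least multiplicity of \<open>w\<close> are those
      that outlive its elimination. The different multiplicities in \<open>a\<close> and
      \<open>b\<close> prevent \<open>Q'\<close> from being all of \<open>Q\<close>.\<close>
    define m where "m = Min (n ` Q)"
    define Q' where "Q' = {q \<in> Q. n q = m}"
    have m_le: "m \<le> n q" if "q \<in> Q" for q using that fin by (auto simp: m_def)
    have "m \<in> n ` Q" unfolding m_def using fin ab by (intro Min_in) auto
    then have Q'_ne: "Q' \<noteq> {}" by (auto simp: Q'_def)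
    have "a \<notin> Q' \<or> b \<notin> Q'" using neq by (auto simp: Q'_def n_def)
    then have Q'_sub: "Q' \<subset> Q" using ab by (auto simp: Q'_def)
    have fin': "finite Q'" using Q'_sub fin finite_subset by blast
    obtain \<sigma> where \<sigma>: "fixing_hom K \<sigma>" and \<sigma>0: "\<And>v. v \<in> W \<Longrightarrow> \<sigma> v = \<zero> \<longleftrightarrow> (\<exists>c\<in>k0. v = c \<otimes> w)"
      using elimination[OF Us w(1)] w(2) K by auto
    interpret \<sigma>: ring_hom_cring R R \<sigma> using \<sigma> by (rule fixing_hom_cring)
    have \<sigma>_iff: "\<sigma> v = \<zero> \<longleftrightarrow> v = \<zero> \<or> proportional v w" if v: "v \<in> W" for v
    proof -
      have "(\<exists>c\<in>k0. v = c \<otimes> w) \<longleftrightarrow> v = \<zero> \<or> proportional v w"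
        unfolding proportional_def using w by (auto intro: bexI[of _ \<zero>])
      then show ?thesis using \<sigma>0[OF v] by simp
    qed
    define \<phi>' where "\<phi>' = \<sigma> \<circ> \<phi>"
    have \<phi>': "fixing_hom K \<phi>'" unfolding \<phi>'_def using \<phi> \<sigma> by (rule fixing_hom_comp)
    define E where "E q = surviving K \<phi> q" for q
    define Ew where "Ew q = {j. j < d \<and> proportional (\<phi> (l q j)) w}" for q
    have n_card: "n q = card (Ew q)" for q by (simp add: n_def occurrences_def Ew_def)
    have fE: "finite (E q)" "finite (Ew q)" for q by (auto simp: E_def Ew_def surviving_def)
    \<comment> \<open>\<open>\<phi>\<close> fixes \<open>K\<close> and \<open>w\<close> is outside
      \<open>K\<close>, so a form with image proportional to \<open>w\<close> is neither in
      \<open>K\<close> nor killed. All these factors are therefore visible in the relation.\<close>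
    have Ew_sub: "Ew q \<subseteq> E q" if q: "q \<in> Q" for q
    proof
      fix j assume j: "j \<in> Ew q"
      then have "\<phi> (l q j) \<in> W" "proportional (\<phi> (l q j)) w" "j < d" using l q \<phi>D by (auto simp: Ew_def)
      then have "\<phi> (l q j) \<notin> K" "\<phi> (l q j) \<noteq> \<zero>"
        using proportional_Span_iff[OF Us _ w(1)] w K w0 proportional_zero[of _ w] by auto
      then show "j \<in> E q" using \<phi>D(3)[of "l q j"] \<open>j < d\<close> by (auto simp: E_def surviving_def)
    qed
    have \<phi>l: "\<phi> (l q j) \<in> W" if "q \<in> Q" "j < d" for q j using that l \<phi>D by auto
    define Z where "Z q = (\<Otimes>j\<in>E q - Ew q. \<phi> (l q j))" for q
    have E_lt: "j \<in> E q \<Longrightarrow> j < d" "j \<in> Ew q \<Longrightarrow> j < d" for j q by (auto simp: E_def Ew_def surviving_def)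
    have Z_closed: "Z q \<in> carrier R" if "q \<in> Q" for q
      unfolding Z_def using \<phi>l[OF that] E_lt by (intro finprod_closed) auto
    have "\<exists>c\<in>k0 - {\<zero>}. (\<Otimes>j\<in>Ew q. \<phi> (l q j)) = c \<otimes> w [^] n q" if q: "q \<in> Q" for q
      unfolding n_card
    proof (rule finprod_proportional_const)
      show "(\<lambda>j. \<phi> (l q j)) \<in> Ew q \<rightarrow> W" using \<phi>l[OF q] E_lt(2) by blast
      show "\<And>j. j \<in> Ew q \<Longrightarrow> proportional (\<phi> (l q j)) w" by (simp add: Ew_def)
    qed (use fE w in simp_all)
    then obtain \<gamma> where \<gamma>: "\<And>q. q \<in> Q \<Longrightarrow> \<gamma> q \<in> k0 - {\<zero>}"
      "\<And>q. q \<in> Q \<Longrightarrow> (\<Otimes>j\<in>Ew q. \<phi> (l q j)) = \<gamma> q \<otimes> w [^] n q"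
      by metis
    \<comment> \<open>The term of \<open>q\<close> divided by the \<open>m\<close>-th power of
      \<open>w\<close>.\<close>
    define Y where "Y q = B q \<otimes> \<gamma> q \<otimes> Z q \<otimes> w [^] (n q - m)" for q
    have B: "B q \<in> carrier R" "B q \<noteq> \<zero>" if "q \<in> Q" for q using that less.prems(6) by auto
    have Y_closed: "Y q \<in> carrier R" if "q \<in> Q" for q
      using that B \<gamma>(1)[OF that] Z_closed w by (auto simp: Y_def)
    have term_eq: "B q \<otimes> (\<Otimes>j\<in>surviving K \<phi> q. \<phi> (l q j)) = w [^] m \<otimes> Y q" if q: "q \<in> Q" for q
    proof -
      have "E q = (E q - Ew q) \<union> Ew q" using Ew_sub[OF q] by auto
      then have "(\<Otimes>j\<in>E q. \<phi> (l q j)) = (\<Otimes>j\<in>(E q - Ew q) \<union> Ew q. \<phi> (l q j))" by simp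
      also have "\<dots> = Z q \<otimes> (\<Otimes>j\<in>Ew q. \<phi> (l q j))"
        unfolding Z_def using fE \<phi>l[OF q] E_lt by (intro finprod_Un_disjoint) auto
      also have "\<dots> = Z q \<otimes> (\<gamma> q \<otimes> (w [^] m \<otimes> w [^] (n q - m)))"
        using \<gamma>(2)[OF q] m_le[OF q] w by (simp add: nat_pow_mult)
      finally show ?thesis
        using B[OF q] \<gamma>(1)[OF q] Z_closed[OF q] w unfolding Y_def E_def by (simp add: m_ac)
    qed
    have "\<zero> = (\<Oplus>q\<in>Q. w [^] m \<otimes> Y q)"
      unfolding less.prems(7)[symmetric]
      by (rule add.finprod_cong') (use term_eq Y_closed w in auto)
    also have "\<dots> = w [^] m \<otimes> (\<Oplus>q\<in>Q. Y q)"
      using fin w Y_closed by (intro finsum_rdistr[symmetric]) auto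
    finally have "(\<Oplus>q\<in>Q. Y q) = \<zero>"
      using integral[of "w [^] m" "\<Oplus>q\<in>Q. Y q"] w w0 nat_pow_nonzero[of w m] Y_closed
      by (auto intro: finsum_closed)
    then have "(\<Oplus>q\<in>Q. \<sigma> (Y q)) = \<zero>"
      using \<sigma>.hom_finsum[of Y Q] Y_closed by (auto simp: o_def)
    \<comment> \<open>Terms that still contain \<open>w\<close> vanish under
      \<open>\<sigma>\<close>. If \<open>n q = m\<close>, then all factors proportional to
      \<open>w\<close> have been cancelled, and no remaining factor is sent to zero.\<close>
    moreover have "(\<Oplus>q\<in>Q. \<sigma> (Y q)) =
        (\<Oplus>q\<in>Q'. (B q \<otimes> \<gamma> q) \<otimes> (\<Otimes>j\<in>surviving K \<phi>' q. \<phi>' (l q j)))"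
    proof (rule add.finprod_mono_neutral_cong_right)
      fix q assume "q \<in> Q - Q'"
      then have q: "q \<in> Q" "m < n q" using m_le by (auto simp: Q'_def order_less_le)
      have "\<sigma> w = \<zero>" using \<sigma>_iff[OF w(1)] proportional_refl[OF w(1)] by simp
      then have "\<sigma> (w [^] (n q - m)) = \<zero>"
        using q w by (cases "n q - m") auto
      then show "\<sigma> (Y q) = \<zero>"
        using B[OF q(1)] \<gamma>(1)[OF q(1)] Z_closed[OF q(1)] w unfolding Y_def by simp
    next
      fix q assume "q \<in> Q'"
      then have q: "q \<in> Q" "n q = m" by (auto simp: Q'_def)
      have "surviving K \<phi>' q = E q - Ew q"
        using \<sigma>_iff \<phi>l[OF q(1)] by (auto simp: surviving_def E_def Ew_def \<phi>'_def)
      moreover have "\<sigma> (Z q) = (\<Otimes>j\<in>E q - Ew q. \<phi>' (l q j))"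
        unfolding Z_def \<phi>'_def using \<phi>l[OF q(1)] E_lt
        by (subst \<sigma>.hom_finprod) (auto simp: o_def)
      moreover have "\<sigma> (B q) = B q" "\<sigma> (\<gamma> q) = \<gamma> q"
        using less.prems(6) q \<sigma> \<gamma>(1)[OF q(1)] fixing_homD(2)[OF \<sigma>] by auto
      ultimately show "\<sigma> (Y q) = (B q \<otimes> \<gamma> q) \<otimes> (\<Otimes>j\<in>surviving K \<phi>' q. \<phi>' (l q j))"
        using B[OF q(1)] \<gamma>(1)[OF q(1)] Z_closed[OF q(1)] w q unfolding Y_def by simp
    qed (use fin Q'_sub Y_closed in auto)
    ultimately have rel: "(\<Oplus>q\<in>Q'. (B q \<otimes> \<gamma> q) \<otimes> (\<Otimes>j\<in>surviving K \<phi>' q. \<phi>' (l q j))) = \<zero>"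
      by simp
    have B': "B q \<otimes> \<gamma> q \<in> carrier R - {\<zero>}" if "q \<in> Q" for q
      using B[OF that] \<gamma>(1)[OF that] integral[of "B q" "\<gamma> q"] by auto
    have \<phi>'l: "\<phi>' (l q j) \<in> W" if "q \<in> Q" "j < d" for q j
      using fixing_homD(1)[OF \<phi>' l[OF that]] .
    have prod': "(\<Otimes>j\<in>surviving K \<phi>' q. \<phi>' (l q j)) \<in> carrier R - {\<zero>}" if q: "q \<in> Q" for q
      by (rule finprod_nonzero) (use \<phi>'l[OF q] in \<open>auto simp: surviving_def\<close>)
    \<comment> \<open>A single remaining term would be a vanishing product of nonzero elements of a
      domain.\<close>
    have card': "2 \<le> card Q'"
    proof (rule ccontr)
      assume "\<not> 2 \<le> card Q'"
      then have "card Q' = 1" using Q'_ne fin' by (simp add: not_le less_2_cases_iff)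
      then obtain q where q: "Q' = {q}" by (auto simp: card_1_singleton_iff)
      then have "q \<in> Q" using Q'_sub by auto
      then have "(B q \<otimes> \<gamma> q) \<otimes> (\<Otimes>j\<in>surviving K \<phi>' q. \<phi>' (l q j)) = \<zero>"
        using rel B'[of q] prod'[of q] unfolding q by simp
      then show False using B'[OF \<open>q \<in> Q\<close>] prod'[OF \<open>q \<in> Q\<close>] integral by blast
    qed
    \<comment> \<open>The kernel of \<open>\<sigma> \<circ> \<phi>\<close> on \<open>W\<close> gains
      one direction, the preimage of the line of \<open>w\<close>. Some form of the circuit has its
      image on this line and can be added to \<open>L\<close>.\<close>
    have "\<exists>q0\<in>Q. \<exists>j<d. proportional (\<phi> (l q0 j)) w"
    proof (rule ccontr)
      assume "\<not> ?thesis"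
      then have "occurrences \<phi> a w = 0" "occurrences \<phi> b w = 0"
        using ab by (auto simp: occurrences_def)
      then show False using neq by simp
    qed
    then obtain q0 j0 where q0: "q0 \<in> Q" "j0 < d" "proportional (\<phi> (l q0 j0)) w" by blast
    define L' where "L' = l q0 j0 # L"
    have L': "set L' \<subseteq> W" using less.prems(4) l q0 by (auto simp: L'_def)
    have "\<forall>v\<in>W. \<phi>' v = \<zero> \<longrightarrow> v \<in> Span k0 L'"
    proof (intro ballI impI)
      fix v assume v: "v \<in> W" "\<phi>' v = \<zero>"
      then obtain c where c: "c \<in> k0" "\<phi> v = c \<otimes> w"
        using \<sigma>0[of "\<phi> v"] \<phi>D(1) by (auto simp: \<phi>'_def)
      obtain e where e: "e \<in> k0 - {\<zero>}" "w = e \<otimes> \<phi> (l q0 j0)"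
        using proportional_sym[OF q0(3) w(1)] by (auto simp: proportional_def)
      define x where "x = (c \<otimes> e) \<otimes> l q0 j0"
      have x: "x \<in> W" using c e l q0 by (simp add: x_def)
      have "\<phi> x = \<phi> v"
        using \<phi>D(4)[of "c \<otimes> e" "l q0 j0"] c e l[OF q0(1,2)] \<phi>D(1)[OF l[OF q0(1,2)]]
        by (simp add: x_def m_assoc)
      then have "\<phi> (v \<ominus> x) = \<zero>" using \<phi>D(6)[OF v(1) x] v x \<phi>D(1)[OF v(1)] by (simp add: a_minus_def r_neg)
      then have "v \<ominus> x \<in> Span k0 L" using less.prems(5) v x by simp
      moreover have "v = (c \<otimes> e) \<otimes> l q0 j0 \<oplus> (v \<ominus> x)"
        using v x unfolding x_def[symmetric] by (simp add: a_minus_def a_lcomm r_neg)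
      ultimately show "v \<in> Span k0 L'"
        unfolding L'_def Span_Cons_iff using c e
        by (intro bexI[of _ "c \<otimes> e"] bexI[of _ "v \<ominus> x"]) auto
    qed
    moreover have "\<forall>q\<in>Q'. B q \<otimes> \<gamma> q \<in> carrier R - {\<zero>} \<and>
        (\<forall>\<tau>. fixing_hom K \<tau> \<longrightarrow> \<tau> (B q \<otimes> \<gamma> q) = B q \<otimes> \<gamma> q)"
    proof (intro ballI conjI allI impI)
      fix q \<tau> assume "q \<in> Q'" and \<tau>: "fixing_hom K \<tau>"
      then have q: "q \<in> Q" using Q'_sub by auto
      interpret \<tau>: ring_hom_cring R R \<tau> using \<tau> by (rule fixing_hom_cring)
      have "\<tau> (B q) = B q" using less.prems(6) q \<tau> by blast
      then show "\<tau> (B q \<otimes> \<gamma> q) = B q \<otimes> \<gamma> q"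
        using B[OF q] \<gamma>(1)[OF q] fixing_homD(2)[OF \<tau>] by simp
    qed (use B' Q'_sub in auto)
    ultimately have "\<exists>a\<in>Q'. \<exists>b\<in>Q'. a \<noteq> b \<and> (\<exists>\<phi>'' L''. fixing_hom K \<phi>'' \<and> set L'' \<subseteq> W \<and>
      (\<forall>v\<in>W. \<phi>'' v = \<zero> \<longrightarrow> v \<in> Span k0 L'') \<and> length L'' \<le> length L' + card Q' \<and> matched K \<phi>'' a b)"
      using less.hyps[OF psubset_card_mono[OF fin Q'_sub] \<phi>' _ card' L' _ _ rel] Q'_sub less.prems(2)
      by auto
    \<comment> \<open>\<open>L\<close> gains one form while \<open>Q\<close> loses at least one
      term.\<close>
    moreover have "length L' + card Q' \<le> length L + card Q"
      using psubset_card_mono[OF fin Q'_sub] by (simp add: L'_def)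
    ultimately show ?thesis using Q'_sub by (meson order_trans psubsetD)
  qed
qed

end

lemma (in comm_monoid) dvd_finprod:
  assumes "finite A" "a \<in> A" "f \<in> A \<rightarrow> carrier G" "x \<in> carrier G" "x divides f a"
  shows "x divides finprod G f A"
proof -
  have "A = insert a (A - {a})" using assms by auto
  then have "finprod G f A = finprod G f (insert a (A - {a}))" by simp
  also have "\<dots> = f a \<otimes> finprod G f (A - {a})" using assms by (intro finprod_insert) auto
  finally show ?thesis using assms by (auto intro!: divides_prod_r finprod_closed)
qed

section \<open>The relation between classes of equivalent terms\<close>

locale zero_circuit = form_products +
  fixes \<alpha> :: "nat \<Rightarrow> 'a"
  assumes \<alpha>: "i < k \<Longrightarrow> \<alpha> i \<in> k0 - {\<zero>}"
    and identity: "(\<Oplus>i\<in>{..<k}. \<alpha> i \<otimes> (\<Otimes>j\<in>{..<d}. l i j)) = \<zero>"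
    and minimal: "S \<subset> {..<k} \<Longrightarrow> S \<noteq> {} \<Longrightarrow> (\<Oplus>i\<in>S. \<alpha> i \<otimes> (\<Otimes>j\<in>{..<d}. l i j)) \<noteq> \<zero>"
    and simple: "u \<in> W \<Longrightarrow> u \<noteq> \<zero> \<Longrightarrow> \<exists>i<k. \<not> u divides \<alpha> i \<otimes> (\<Otimes>j\<in>{..<d}. l i j)"
begin

lemma matched_refl: "matched K \<phi> a a"
  and matched_sym: "matched K \<phi> a b \<Longrightarrow> matched K \<phi> b a"
  and matched_trans: "matched K \<phi> a b \<Longrightarrow> matched K \<phi> b c \<Longrightarrow> matched K \<phi> a c"
  by (auto simp: matched_def)

text \<open>That the two terms are inequivalent before the substitution matters as much as that they
  are matched after it: it supplies an unbalanced form outside \<open>K\<close>, which limits how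
  often the pair can have been matched so far.\<close>

lemma matching_exists:
  assumes Us: "set Us \<subseteq> W" and K: "K = Span k0 Us" and i0: "i0 < k" "j0 < d" "l i0 j0 \<notin> K"
  shows "\<exists>a<k. \<exists>b<k. \<not> matched K (\<lambda>v. v) a b \<and> (\<exists>\<phi> L. fixing_hom K \<phi> \<and> set L \<subseteq> W \<and>
    (\<forall>v\<in>W. \<phi> v = \<zero> \<longrightarrow> v \<in> Span k0 L) \<and> length L \<le> k \<and> matched K \<phi> a b)"
proof -
  define T where "T i = \<alpha> i \<otimes> (\<Otimes>j\<in>{..<d}. l i j)" for i
  define rep where "rep i = (LEAST i'. matched K (\<lambda>v. v) i' i)" for i
  define Q where "Q = rep ` {..<k}"
  define cl where "cl q = {i. i < k \<and> rep i = q}" for q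
  have rep: "matched K (\<lambda>v. v) (rep i) i" for i
    unfolding rep_def by (rule LeastI[of _ i]) (rule matched_refl)
  have rep_le: "rep i \<le> i" for i
    unfolding rep_def by (rule Least_le) (rule matched_refl)
  have rep_eq: "rep i = rep i'" if "matched K (\<lambda>v. v) i i'" for i i'
    unfolding rep_def using that matched_trans matched_sym by metis
  have Q_lt: "q < k" if "q \<in> Q" for q
    using that rep_le by (auto simp: Q_def intro: le_less_trans)
  have Q_rep: "rep q = q" if "q \<in> Q" for q
    using that rep rep_eq by (auto simp: Q_def)
  have Q_fin: "finite Q" by (simp add: Q_def)
  have card_Q_le: "card Q \<le> k" using card_image_le[of "{..<k}" rep] by (simp add: Q_def)
  have zero_K: "\<zero> \<in> K" using Span_ops(1)[OF Us] K by simp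
  have l_nz: "l i j \<noteq> \<zero>" if "l i j \<notin> K" for i j using that zero_K by metis
  define E where "E i = surviving K (\<lambda>v. v) i" for i
  have E: "E i = {j. j < d \<and> l i j \<notin> K}" for i
    using l_nz by (auto simp: E_def surviving_def)
  \<comment> \<open>A form outside \<open>K\<close> is never proportional to one inside, so the
    parts outside \<open>K\<close> of equivalent terms have equal counts in every proportionality
    class.\<close>
  have "\<exists>c\<in>k0 - {\<zero>}. (\<Otimes>j\<in>E i. l i j) = c \<otimes> (\<Otimes>j\<in>E (rep i). l (rep i) j)" if i: "i < k" for i
  proof -
    have ri: "rep i < k" using rep_le[of i] i by simp
    have "card {j \<in> E i. proportional (l i j) u} = card {j \<in> E (rep i). proportional (l (rep i) j) u}"
      if u: "u \<in> W" for u
    proof (cases "u \<in> K")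
      case True
      then have "{j \<in> E i'. proportional (l i' j) u} = {}" for i'
        using proportional_Span_iff[OF Us _ u] K by (auto simp: E)
      then show ?thesis by (simp only:)
    next
      case False
      then have "{j \<in> E i'. proportional (l i' j) u} = {j. j < d \<and> proportional (l i' j) u}" for i'
        using proportional_Span_iff[OF Us _ u] K by (auto simp: E)
      moreover have "occurrences (\<lambda>v. v) (rep i) u = occurrences (\<lambda>v. v) i u"
        using rep[of i] u False by (auto simp: matched_def)
      ultimately show ?thesis by (simp add: occurrences_def)
    qed
    moreover have "finite (E i)" "finite (E (rep i))" by (simp_all add: E)
    moreover have "l i \<in> E i \<rightarrow> W" "l (rep i) \<in> E (rep i) \<rightarrow> W" using i ri by (auto simp: E)
    ultimately show ?thesis using proportional_families by blast
  qed
  then obtain \<gamma> where \<gamma>: "\<And>i. i < k \<Longrightarrow> \<gamma> i \<in> k0 - {\<zero>}"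
    "\<And>i. i < k \<Longrightarrow> (\<Otimes>j\<in>E i. l i j) = \<gamma> i \<otimes> (\<Otimes>j\<in>E (rep i). l (rep i) j)"
    by metis
  define G where "G i = (\<Otimes>j\<in>E i. l i j)" for i
  \<comment> \<open>\<open>b i\<close> collects the scalars and the forms in \<open>K\<close>, that
    is, everything in which the terms of a class may differ beyond the common factor
    \<open>G (rep i)\<close>.\<close>
  define b where "b i = \<alpha> i \<otimes> \<gamma> i \<otimes> (\<Otimes>j\<in>{j. j < d \<and> l i j \<in> K}. l i j)" for i
  have G_closed: "G i \<in> carrier R" if "i < k" for i
    unfolding G_def using that by (intro finprod_closed) (auto simp: E)
  have Kpart_closed: "(\<Otimes>j\<in>{j. j < d \<and> l i j \<in> K}. l i j) \<in> carrier R" if "i < k" for i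
    using that by (intro finprod_closed) auto
  have b_closed: "b i \<in> carrier R" if "i < k" for i
    using that \<alpha>[OF that] \<gamma>(1)[OF that] Kpart_closed[OF that] by (simp add: b_def)
  have T: "T i = b i \<otimes> G (rep i)" if i: "i < k" for i
  proof -
    have "{..<d} = {j. j < d \<and> l i j \<in> K} \<union> E i" by (auto simp: E)
    then have "(\<Otimes>j\<in>{..<d}. l i j) = (\<Otimes>j\<in>{j. j < d \<and> l i j \<in> K} \<union> E i. l i j)" by simp
    also have "\<dots> = (\<Otimes>j\<in>{j. j < d \<and> l i j \<in> K}. l i j) \<otimes> (\<Otimes>j\<in>E i. l i j)"
      using i by (intro finprod_Un_disjoint) (auto simp: E)
    also have "(\<Otimes>j\<in>E i. l i j) = \<gamma> i \<otimes> G (rep i)" using \<gamma>(2)[OF i] by (simp add: G_def)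
    finally show ?thesis
      using \<alpha>[OF i] \<gamma>(1)[OF i] Kpart_closed[OF i] G_closed[of "rep i"] rep_le[of i] i
      unfolding T_def b_def by (simp add: m_ac)
  qed
  have b_fixed: "\<sigma> (b i) = b i" if i: "i < k" and \<sigma>: "fixing_hom K \<sigma>" for i \<sigma>
  proof -
    interpret \<sigma>: ring_hom_cring R R \<sigma> using \<sigma> by (rule fixing_hom_cring)
    have "\<sigma> (\<Otimes>j\<in>{j. j < d \<and> l i j \<in> K}. l i j) = (\<Otimes>j\<in>{j. j < d \<and> l i j \<in> K}. (\<sigma> \<circ> l i) j)"
      using i by (intro \<sigma>.hom_finprod) auto
    also have "\<dots> = (\<Otimes>j\<in>{j. j < d \<and> l i j \<in> K}. l i j)"
      using i fixing_homD(3)[OF \<sigma>] by (intro finprod_cong') auto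
    finally show ?thesis
      using \<alpha>[OF i] \<gamma>(1)[OF i] Kpart_closed[OF i] fixing_homD(2)[OF \<sigma>] by (simp add: b_def)
  qed
  \<comment> \<open>With a single class, each term would contain a form proportional to
    \<open>l i0 j0\<close>, contrary to simplicity.\<close>
  have two: "2 \<le> card Q"
  proof (rule ccontr)
    assume "\<not> 2 \<le> card Q"
    then have "card Q \<le> Suc 0" by simp
    then have "\<forall>x\<in>Q. \<forall>y\<in>Q. x = y" using card_le_Suc0_iff_eq[OF Q_fin] by blast
    then have "rep i = rep i0" if "i < k" for i
      using that i0(1) unfolding Q_def by blast
    then have eqv: "matched K (\<lambda>v. v) i0 i" if "i < k" for i
      using that rep matched_trans matched_sym by metis
    have u: "l i0 j0 \<in> W" "l i0 j0 \<noteq> \<zero>" using i0 l_nz by auto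
    have "l i0 j0 divides \<alpha> i \<otimes> (\<Otimes>j\<in>{..<d}. l i j)" if i: "i < k" for i
    proof -
      have "j0 \<in> {j. j < d \<and> proportional (l i0 j) (l i0 j0)}" using i0 proportional_refl[OF u(1)] by auto
      then have "occurrences (\<lambda>v. v) i0 (l i0 j0) \<noteq> 0" unfolding occurrences_def by (subst card_0_eq) auto
      then have "occurrences (\<lambda>v. v) i (l i0 j0) \<noteq> 0" using eqv[OF i] i0 u by (auto simp: matched_def)
      then obtain j where j: "j < d" "proportional (l i j) (l i0 j0)"
        unfolding occurrences_def by (metis (mono_tags, lifting) Collect_empty_eq card.empty)
      then obtain c where c: "c \<in> k0 - {\<zero>}" "l i j = c \<otimes> l i0 j0" by (auto simp: proportional_def)
      then have "l i0 j0 divides l i j" using u by (auto intro!: dividesI[of c] simp: m_comm)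
      then have "l i0 j0 divides (\<Otimes>j\<in>{..<d}. l i j)"
        using j i u by (intro dvd_finprod[of _ j]) auto
      then show ?thesis using \<alpha>[OF i] i u by (intro divides_prod_l) (auto intro!: finprod_closed)
    qed
    then show False using simple[OF u] by blast
  qed
  define B where "B q = (\<Oplus>i\<in>cl q. b i)" for q
  have cl_lt: "i < k" if "i \<in> cl q" for i q using that by (simp add: cl_def)
  have B_closed: "B q \<in> carrier R" for q
    unfolding B_def using b_closed cl_lt by (intro finsum_closed) auto
  have T_closed: "T i \<in> carrier R" if "i < k" for i
    using T[OF that] b_closed[OF that] G_closed[of "rep i"] rep_le[of i] that by simp
  have BG: "B q \<otimes> G q = (\<Oplus>i\<in>cl q. T i)" if q: "q \<in> Q" for q
  proof -
    have "B q \<otimes> G q = (\<Oplus>i\<in>cl q. b i \<otimes> G q)"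
      unfolding B_def
    proof (rule finsum_ldistr)
      show "finite (cl q)" by (simp add: cl_def)
      show "G q \<in> carrier R" using G_closed[OF Q_lt[OF q]] .
      show "b \<in> cl q \<rightarrow> carrier R" using b_closed cl_lt by blast
    qed
    also have "\<dots> = (\<Oplus>i\<in>cl q. T i)"
      by (rule add.finprod_cong') (use T T_closed in \<open>auto simp: cl_def\<close>)
    finally show ?thesis .
  qed
  \<comment> \<open>As there are two classes, each is a proper nonempty subset of the terms, and
    minimality forbids that its sum vanishes.\<close>
  have B_nz: "B q \<noteq> \<zero>" if q: "q \<in> Q" for q
  proof
    assume "B q = \<zero>"
    then have "(\<Oplus>i\<in>cl q. T i) = \<zero>" using BG[OF q] G_closed[OF Q_lt[OF q]] by simp
    moreover obtain q' where q': "q' \<in> Q" "q' \<noteq> q"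
      using two q Q_fin card_le_Suc0_iff_eq[of Q] by (metis not_less_eq_eq numeral_2_eq_2)
    then have "q' \<notin> cl q" "q' \<in> {..<k}" using Q_rep Q_lt by (auto simp: cl_def)
    then have "cl q \<subset> {..<k}" using cl_lt by blast
    moreover have "q \<in> cl q" using q Q_lt Q_rep by (simp add: cl_def)
    ultimately show False using minimal[of "cl q"] by (auto simp: T_def)
  qed
  have B_fixed: "\<sigma> (B q) = B q" if \<sigma>: "fixing_hom K \<sigma>" for \<sigma> q
  proof -
    interpret \<sigma>: ring_hom_cring R R \<sigma> using \<sigma> by (rule fixing_hom_cring)
    have "\<sigma> (B q) = (\<Oplus>i\<in>cl q. (\<sigma> \<circ> b) i)"
      unfolding B_def using b_closed cl_lt by (intro \<sigma>.hom_finsum) auto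
    also have "\<dots> = B q"
      unfolding B_def using b_closed cl_lt b_fixed[OF _ \<sigma>] by (intro add.finprod_cong') auto
    finally show ?thesis .
  qed
  have "(\<Oplus>q\<in>Q. B q \<otimes> G q) = (\<Oplus>q\<in>Q. (\<Oplus>i\<in>cl q. T i))"
    by (rule add.finprod_cong') (use BG T_closed in \<open>auto simp: cl_def intro!: finsum_closed\<close>)
  also have "\<dots> = (\<Oplus>i\<in>(\<Union>q\<in>Q. cl q). T i)"
    by (rule add.finprod_UN_disjoint[symmetric])
      (use Q_fin T_closed in \<open>auto simp: cl_def pairwise_def disjnt_def\<close>)
  also have "(\<Union>q\<in>Q. cl q) = {..<k}" by (auto simp: Q_def cl_def)
  also have "(\<Oplus>i\<in>{..<k}. T i) = \<zero>" using identity by (simp add: T_def)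
  finally have "(\<Oplus>q\<in>Q. B q \<otimes> (\<Otimes>j\<in>surviving K (\<lambda>v. v) q. l q j)) = \<zero>"
    by (simp add: G_def E_def)
  \<comment> \<open>The elimination starts from the identity map and the empty list, so the number
    of classes, at most \<open>k\<close>, bounds the number of eliminated forms.\<close>
  then have "\<exists>a\<in>Q. \<exists>b\<in>Q. a \<noteq> b \<and> (\<exists>\<phi>' L'. fixing_hom K \<phi>' \<and> set L' \<subseteq> W \<and>
    (\<forall>v\<in>W. \<phi>' v = \<zero> \<longrightarrow> v \<in> Span k0 L') \<and> length L' \<le> length ([] :: 'a list) + card Q \<and> matched K \<phi>' a b)"
    using B_closed B_nz B_fixed Q_lt two
    by (intro matching_of_relation[OF Us K fixing_hom_id, where B = B]) auto
  then obtain a b \<phi> L where ab: "a \<in> Q" "b \<in> Q" "a \<noteq> b" and \<phi>: "fixing_hom K \<phi>" "set L \<subseteq> W"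
    "\<forall>v\<in>W. \<phi> v = \<zero> \<longrightarrow> v \<in> Span k0 L" "length L \<le> k" "matched K \<phi> a b"
    using card_Q_le by auto
  moreover have "\<not> matched K (\<lambda>v. v) a b" using ab Q_rep rep_eq by metis
  ultimately show ?thesis using Q_lt by blast
qed

section \<open>The potential that doubles\<close>

abbreviation count_forms :: "nat \<Rightarrow> 'a \<Rightarrow> nat" where
  "count_forms \<equiv> occurrences (\<lambda>v. v)"

text \<open>Proportionality in the quotient of \<open>W\<close> by \<open>K\<close>.\<close>

definition similar_mod :: "'a set \<Rightarrow> 'a \<Rightarrow> 'a \<Rightarrow> bool" where
  "similar_mod K v u \<longleftrightarrow> (\<exists>c\<in>k0 - {\<zero>}. \<exists>x\<in>K. v = c \<otimes> u \<oplus> x)"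

definition excess_indices :: "'a set \<Rightarrow> nat \<Rightarrow> nat \<Rightarrow> nat \<Rightarrow> 'a \<Rightarrow> nat set" where
  "excess_indices K a b i u =
    {j. j < d \<and> count_forms a (l i j) \<noteq> count_forms b (l i j) \<and> similar_mod K (l i j) u}"

text \<open>Indices are counted, hence forms with repetition, which gives the bound
  \<open>2 * d\<close>. Whether a form is unbalanced does not depend on \<open>K\<close>; enlarging
  \<open>K\<close> only merges classes, so the excess cannot drop.\<close>

definition excess :: "'a set \<Rightarrow> nat \<Rightarrow> nat \<Rightarrow> 'a \<Rightarrow> nat" where
  "excess K a b u = card (excess_indices K a b a u) + card (excess_indices K a b b u)"

lemma finite_excess_indices [simp]: "finite (excess_indices K a b i u)"
  by (simp add: excess_indices_def)

lemma excess_le: "excess K a b u \<le> 2 * d"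
proof -
  have "card (excess_indices K a b i u) \<le> d" for i
    using card_mono[of "{..<d}" "excess_indices K a b i u"] by (auto simp: excess_indices_def)
  from this[of a] this[of b] show ?thesis by (simp add: excess_def)
qed

lemma excess_mono: "K \<subseteq> K' \<Longrightarrow> excess K a b u \<le> excess K' a b u"
  unfolding excess_def
  by (intro add_mono card_mono) (auto simp: excess_indices_def similar_mod_def)

lemma occurrences_proportional:
  assumes "v \<in> W" "w \<in> W" "proportional v w"
  shows "occurrences \<phi> i v = occurrences \<phi> i w"
proof -
  have "proportional x v \<longleftrightarrow> proportional x w" for x
    using assms proportional_trans proportional_sym by blast
  then show ?thesis by (simp add: occurrences_def)
qed

text \<open>The initial value of the potential: an unbalanced form occurs, up to a scalar, in one of
  the two terms and belongs to its own class.\<close>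

lemma excess_pos:
  assumes ab: "a < k" "b < k" and u: "u \<in> W" "count_forms a u \<noteq> count_forms b u" and K: "\<zero> \<in> K"
  shows "1 \<le> excess K a b u"
proof -
  have *: "j \<in> excess_indices K a b i u" if "i < k" "j < d" "proportional (l i j) u" for i j
  proof -
    from that(3) obtain c where c: "c \<in> k0 - {\<zero>}" "l i j = c \<otimes> u" by (auto simp: proportional_def)
    have "similar_mod K (l i j) u"
    proof -
      from c have "l i j = c \<otimes> u \<oplus> \<zero>" using u by simp
      then show ?thesis unfolding similar_mod_def using c K by blast
    qed
    then show ?thesis
      using that u occurrences_proportional[OF _ u(1) that(3)] by (simp add: excess_indices_def)
  qed
  have "\<exists>i\<in>{a, b}. \<exists>j<d. proportional (l i j) u"
  proof (rule ccontr)
    assume "\<not> ?thesis"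
    then have "count_forms a u = 0" "count_forms b u = 0" by (auto simp: occurrences_def)
    then show False using u by simp
  qed
  then have "excess_indices K a b a u \<noteq> {} \<or> excess_indices K a b b u \<noteq> {}"
    using * ab by blast
  then show ?thesis
    unfolding excess_def by (auto simp: Suc_le_eq card_gt_0_iff)
qed

text \<open>
  A form \<open>u\<close> whose multiplicities in the two terms differ is matched with another such form \<open>y\<close>,
  congruent to \<open>u\<close> modulo the matching. Both classes modulo \<open>K\<close> lie in the class of \<open>u\<close> modulo
  the larger span, and they are disjoint because \<open>\<phi>\<close> is the identity on \<open>K\<close>.
\<close>

lemma excess_doubling:
  assumes Us: "set Us \<subseteq> W" and L: "set L \<subseteq> W" and K: "K = Span k0 Us"
    and \<phi>: "fixing_hom K \<phi>" "\<forall>v\<in>W. \<phi> v = \<zero> \<longrightarrow> v \<in> Span k0 L" "matched K \<phi> a b"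
    and ab: "a < k" "b < k"
    and M: "\<And>y. y \<in> W - K \<Longrightarrow> count_forms a y \<noteq> count_forms b y \<Longrightarrow> M \<le> excess K a b y"
    and u: "u \<in> W - Span k0 (Us @ L)" "count_forms a u \<noteq> count_forms b u"
  shows "2 * M \<le> excess (Span k0 (Us @ L)) a b u"
proof -
  define K' where "K' = Span k0 (Us @ L)"
  have UL: "set (Us @ L) \<subseteq> W" using Us L by simp
  note \<phi>D = fixing_homD[OF \<phi>(1)]
  have K_W: "K \<subseteq> W" using Span_subset_W[OF Us] K by simp
  have uW: "u \<in> W" using u by simp
  have K'I: "x \<oplus> y \<in> K'" if "x \<in> K" "y \<in> Span k0 L" for x y
    unfolding K'_def Span_append_iff[OF Us L] using that K by blast
  have L_sub: "Span k0 L \<subseteq> K'"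
    using K'I[of \<zero>] Span_ops(1)[OF Us] K Span_subset_W[OF L] by force
  have K_sub: "K \<subseteq> K'"
    using K'I[of _ \<zero>] Span_ops(1)[OF L] K_W by force
  \<comment> \<open>If \<open>\<phi> u\<close> were in \<open>K\<close>, then \<open>u\<close> would
    differ from it by an element killed by \<open>\<phi>\<close>, hence by an element of the span of
    \<open>L\<close>, and would lie in \<open>K'\<close>.\<close>
  have \<phi>u: "\<phi> u \<in> W" "\<phi> u \<notin> K"
  proof -
    show "\<phi> u \<in> W" using \<phi>D(1) uW .
    show "\<phi> u \<notin> K"
    proof
      assume \<phi>uK: "\<phi> u \<in> K"
      then have *: "\<phi> u \<in> W" "\<phi> (\<phi> u) = \<phi> u" using K_W \<phi>D(3) by auto
      then have "\<phi> (u \<ominus> \<phi> u) = \<zero>"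
        using \<phi>D(6)[OF uW *(1)] by (simp add: a_minus_def r_neg)
      then have "u \<ominus> \<phi> u \<in> Span k0 L" using \<phi>(2) uW * by simp
      then have "\<phi> u \<oplus> (u \<ominus> \<phi> u) \<in> K'" using K'I \<phi>uK by blast
      moreover have "\<phi> u \<oplus> (u \<ominus> \<phi> u) = u" using uW * by (simp add: a_minus_def a_lcomm r_neg)
      ultimately show False using u by (simp add: K'_def)
    qed
  qed
  \<comment> \<open>The indices whose forms become proportional to \<open>\<phi> u\<close> only
    through \<open>\<phi>\<close>. The totals of the two terms agree by the matching but the counts
    of \<open>u\<close> do not, so \<open>D a\<close> and \<open>D b\<close> differ in size.\<close>
  define D where "D i = {j. j < d \<and> proportional (\<phi> (l i j)) (\<phi> u) \<and> \<not> proportional (l i j) u}" for i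
  have \<phi>_prop: "proportional (\<phi> v) (\<phi> w)" if "proportional v w" "w \<in> W" for v w
    using that \<phi>D(4) unfolding proportional_def by blast
  have occ_split: "occurrences \<phi> i (\<phi> u) = count_forms i u + card (D i)" for i
  proof -
    have "{j. j < d \<and> proportional (\<phi> (l i j)) (\<phi> u)} = {j. j < d \<and> proportional (l i j) u} \<union> D i"
      using \<phi>_prop uW by (auto simp: D_def)
    then show ?thesis
      unfolding occurrences_def by (subst card_Un_disjoint[symmetric]) (auto simp: D_def)
  qed
  have "occurrences \<phi> a (\<phi> u) = occurrences \<phi> b (\<phi> u)" using \<phi>(3) \<phi>u by (auto simp: matched_def)
  then have card_D: "card (D a) \<noteq> card (D b)" using occ_split[of a] occ_split[of b] u(2) by simp
  \<comment> \<open>If all such forms were balanced, \<open>D a\<close> and \<open>D b\<close> would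
    have equal counts in every proportionality class, and thus equal size.\<close>
  have "\<exists>y\<in>W. proportional (\<phi> y) (\<phi> u) \<and> \<not> proportional y u \<and> count_forms a y \<noteq> count_forms b y"
  proof (rule ccontr)
    assume contra: "\<not> ?thesis"
    have "card {j \<in> D a. proportional (l a j) x} = card {j \<in> D b. proportional (l b j) x}"
      if x: "x \<in> W" for x
    proof (cases "proportional (\<phi> x) (\<phi> u) \<and> \<not> proportional x u")
      case True
      have "{j \<in> D i. proportional (l i j) x} = {j. j < d \<and> proportional (l i j) x}" for i
      proof -
        have "proportional (\<phi> v) (\<phi> u) \<and> \<not> proportional v u" if "proportional v x" for v
          using True that x uW \<phi>u \<phi>_prop[OF that x] proportional_trans proportional_sym by blast
        then show ?thesis by (auto simp: D_def)
      qed
      then show ?thesis using contra True x by (auto simp: occurrences_def)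
    next
      case False
      have "{j \<in> D i. proportional (l i j) x} = {}" if i: "i < k" for i
      proof -
        have "proportional (\<phi> x) (\<phi> u) \<and> \<not> proportional x u"
          if v: "v \<in> W" "proportional v x" "proportional (\<phi> v) (\<phi> u)" "\<not> proportional v u" for v
        proof -
          have "proportional x v" using v x proportional_sym by blast
          then have "proportional (\<phi> x) (\<phi> v)" using \<phi>_prop v by blast
          then show ?thesis using v uW \<phi>u proportional_trans by blast
        qed
        then show ?thesis unfolding D_def using False i l_W by blast
      qed
      then show ?thesis using ab by (simp only:)
    qed
    moreover have "finite (D i)" for i by (simp add: D_def)
    moreover have "l a \<in> D a \<rightarrow> W" "l b \<in> D b \<rightarrow> W" using ab by (auto simp: D_def)
    ultimately have "card (D a) = card (D b)" using proportional_families by blast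
    then show False using card_D by simp
  qed
  then obtain y where y: "y \<in> W" "proportional (\<phi> y) (\<phi> u)" "\<not> proportional y u"
    "count_forms a y \<noteq> count_forms b y" by blast
  from y(2) obtain c where c: "c \<in> k0 - {\<zero>}" "\<phi> y = c \<otimes> \<phi> u" by (auto simp: proportional_def)
  \<comment> \<open>The difference that \<open>\<phi>\<close> does not see. It lies in
    \<open>K'\<close> and so merges the classes of \<open>y\<close> and \<open>u\<close>.\<close>
  define e where "e = y \<ominus> c \<otimes> u"
  have e: "e \<in> W" "\<phi> e = \<zero>"
    using y(1) uW c \<phi>D(6)[of y "c \<otimes> u"] \<phi>D(4)[of c u] \<phi>u by (auto simp: e_def a_minus_def r_neg)
  then have eK': "e \<in> K'" using \<phi>(2) L_sub by auto
  have y_eq: "y = c \<otimes> u \<oplus> e"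
    unfolding e_def using y(1) uW c by (simp add: a_minus_def a_lcomm r_neg)
  have "y \<notin> K'"
  proof
    assume "y \<in> K'"
    then have "y \<ominus> e \<in> K'" using eK' Span_ops(3)[OF UL] by (simp add: K'_def)
    moreover have "y \<ominus> e = c \<otimes> u"
      unfolding y_eq using e uW c by (simp add: a_minus_def a_assoc r_neg)
    ultimately have "c \<otimes> u \<in> K'" by simp
    then show False
      using u proportional_Span_iff[OF UL, of "c \<otimes> u" u] c(1) uW unfolding K'_def proportional_def by blast
  qed
  then have yK: "y \<in> W - K" using K_sub y(1) by auto
  have uK: "u \<in> W - K" using K_sub u by (auto simp: K'_def)
  \<comment> \<open>Applying \<open>\<phi>\<close> to both representations of \<open>v\<close> puts
    a multiple of \<open>\<phi> u\<close> into \<open>K\<close>. Its coefficient must vanish, whence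
    the parts in \<open>K\<close> coincide and \<open>y\<close> would be proportional to
    \<open>u\<close>.\<close>
  have disj: False if v: "similar_mod K v u" "similar_mod K v y" for v
  proof -
    from v obtain c1 x1 c2 x2 where v1: "c1 \<in> k0 - {\<zero>}" "x1 \<in> K" "v = c1 \<otimes> u \<oplus> x1"
      and v2: "c2 \<in> k0 - {\<zero>}" "x2 \<in> K" "v = c2 \<otimes> y \<oplus> x2"
      unfolding similar_mod_def by blast
    have x: "x1 \<in> W" "x2 \<in> W" using v1 v2 K_W by auto
    have "\<phi> v = c1 \<otimes> \<phi> u \<oplus> x1"
      using v1 x uW \<phi>D(5)[of "c1 \<otimes> u" x1] \<phi>D(4)[of c1 u] \<phi>D(3)[of x1] by simp
    moreover have "\<phi> v = c2 \<otimes> (c \<otimes> \<phi> u) \<oplus> x2"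
      using v2 x y(1) c(2) \<phi>D(5)[of "c2 \<otimes> y" x2] \<phi>D(4)[of c2 y] \<phi>D(3)[of x2] by simp
    ultimately have eq: "c1 \<otimes> \<phi> u \<oplus> x1 = c2 \<otimes> (c \<otimes> \<phi> u) \<oplus> x2" by simp
    have cl: "c1 \<in> carrier R" "c2 \<in> carrier R" "c \<in> carrier R" "\<phi> u \<in> carrier R"
      "x1 \<in> carrier R" "x2 \<in> carrier R"
      using v1 v2 c \<phi>u x by auto
    have "(c1 \<ominus> c2 \<otimes> c) \<otimes> \<phi> u = (c1 \<otimes> \<phi> u \<oplus> x1) \<ominus> c2 \<otimes> (c \<otimes> \<phi> u) \<ominus> x1"
      using cl by algebra
    also have "\<dots> = x2 \<ominus> x1" unfolding eq using cl by algebra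
    finally have 1: "(c1 \<ominus> c2 \<otimes> c) \<otimes> \<phi> u = x2 \<ominus> x1" .
    have xK: "x2 \<ominus> x1 \<in> K" using Span_ops(3)[OF Us] v1 v2 K by simp
    have zero: "c1 \<ominus> c2 \<otimes> c = \<zero>"
    proof (rule ccontr)
      assume "c1 \<ominus> c2 \<otimes> c \<noteq> \<zero>"
      then have "proportional (x2 \<ominus> x1) (\<phi> u)"
        unfolding proportional_def using 1 v1 v2 c by (intro bexI[of _ "c1 \<ominus> c2 \<otimes> c"]) auto
      then show False using xK \<phi>u proportional_Span_iff[OF Us] K by blast
    qed
    then have c1: "c1 = c2 \<otimes> c" using cl by simp
    have "x2 \<ominus> x1 = \<zero>" unfolding 1[symmetric] zero using cl by simp
    then have "x1 = x2" using cl by simp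
    then have "c2 \<otimes> (c \<otimes> u) = c2 \<otimes> y"
      using v1(3) v2(3) c1 cl uW y(1) by (simp add: m_assoc)
    then have "y = c \<otimes> u" using v2(1) cl uW y(1) m_lcancel[of c2 "c \<otimes> u" y] by auto
    then show False using y(3) c by (auto simp: proportional_def)
  qed
  have sub: "similar_mod K' v u" if v: "similar_mod K v u \<or> similar_mod K v y" for v
    using v
  proof
    assume "similar_mod K v u"
    then show ?thesis using K_sub unfolding similar_mod_def by blast
  next
    assume "similar_mod K v y"
    then obtain c2 x2 where v2: "c2 \<in> k0 - {\<zero>}" "x2 \<in> K" "v = c2 \<otimes> y \<oplus> x2"
      unfolding similar_mod_def by blast
    have x2: "x2 \<in> W" using v2 K_W by auto
    have "v = (c2 \<otimes> c) \<otimes> u \<oplus> (c2 \<otimes> e \<oplus> x2)"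
      unfolding v2(3) y_eq using v2(1) c(1) uW e(1) x2 by (simp add: r_distr m_assoc a_assoc)
    moreover have "c2 \<otimes> e \<oplus> x2 \<in> K'"
      using v2 eK' K_sub Span_ops(2,4)[OF UL] unfolding K'_def by auto
    ultimately show ?thesis
      unfolding similar_mod_def using k0_units_mult[OF v2(1) c(1)] by blast
  qed
  have card: "card (excess_indices K a b i u) + card (excess_indices K a b i y) \<le>
      card (excess_indices K' a b i u)" for i
  proof -
    have "card (excess_indices K a b i u) + card (excess_indices K a b i y) =
        card (excess_indices K a b i u \<union> excess_indices K a b i y)"
      using disj by (intro card_Un_disjoint[symmetric]) (auto simp: excess_indices_def)
    also have "\<dots> \<le> card (excess_indices K' a b i u)"
      using sub by (intro card_mono) (auto simp: excess_indices_def)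
    finally show ?thesis .
  qed
  have "2 * M \<le> excess K a b u + excess K a b y" using M[OF uK u(2)] M[OF yK y(4)] by simp
  also have "\<dots> \<le> excess K' a b u" using card[of a] card[of b] by (simp add: excess_def)
  finally show ?thesis unfolding K'_def .
qed

text \<open>An extremal argument: among all stages of the construction take one with the most
  matchings in total. A form outside its span would permit another matching.\<close>

theorem spanning_list:
  assumes d: "2 \<le> d"
  shows "\<exists>Us. set Us \<subseteq> W \<and> (\<forall>i<k. \<forall>j<d. l i j \<in> Span k0 Us) \<and>
    real (length Us) \<le> 3 * real k ^ 3 * log 2 (real d)"
proof -
  define P where "P = {..<k} \<times> {..<k}"
  have P: "finite P" "card P = k * k" by (auto simp: P_def card_cartesian_product)
  \<comment> \<open>\<open>r p\<close> counts the matchings of the pair \<open>p\<close>, each of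
    which has cost at most \<open>k\<close> forms. The bound \<open>4 * d\<close> is twice the
    largest possible excess, since the last matching of a pair may leave nothing unbalanced.\<close>
  define st where "st = (\<lambda>(Us, r). set Us \<subseteq> W \<and> length Us \<le> k * (\<Sum>p\<in>P. r p) \<and>
    (\<forall>p\<in>P. 2 ^ r p \<le> 4 * d) \<and>
    (\<forall>a<k. \<forall>b<k. \<forall>u\<in>W - Span k0 Us. count_forms a u \<noteq> count_forms b u \<longrightarrow>
      2 ^ r (a, b) \<le> excess (Span k0 Us) a b u))"
  have "st ([], \<lambda>_. 0)" using d excess_pos by (auto simp: st_def)
  \<comment> \<open>A crude bound, which only ensures that a stage with the most matchings
    exists.\<close>
  moreover have "\<forall>s. st s \<longrightarrow> (\<Sum>p\<in>P. snd s p) < card P * (4 * d) + 1"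
  proof (intro allI impI)
    fix s assume "st s"
    then have "\<forall>p\<in>P. 2 ^ snd s p \<le> 4 * d" by (auto simp: st_def)
    then have "snd s p \<le> 4 * d" if "p \<in> P" for p
      using that by (meson less_exp order.trans less_imp_le)
    then have "(\<Sum>p\<in>P. snd s p) \<le> card P * (4 * d)" using sum_bounded_above[of P "snd s" "4 * d"] by simp
    then show "(\<Sum>p\<in>P. snd s p) < card P * (4 * d) + 1" by simp
  qed
  ultimately obtain s where s: "st s" and s_max: "\<And>s'. st s' \<Longrightarrow> (\<Sum>p\<in>P. snd s' p) \<le> (\<Sum>p\<in>P. snd s p)"
    using ex_has_greatest_nat[of st _ "\<lambda>s. \<Sum>p\<in>P. snd s p"] by blast
  obtain Us r where [simp]: "s = (Us, r)" by (cases s)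
  have Us: "set Us \<subseteq> W" and len: "length Us \<le> k * (\<Sum>p\<in>P. r p)"
    and r_le: "\<And>p. p \<in> P \<Longrightarrow> 2 ^ r p \<le> 4 * d"
    and r_excess: "\<And>a b u. a < k \<Longrightarrow> b < k \<Longrightarrow> u \<in> W - Span k0 Us \<Longrightarrow>
      count_forms a u \<noteq> count_forms b u \<Longrightarrow> 2 ^ r (a, b) \<le> excess (Span k0 Us) a b u"
    using s by (auto simp: st_def)
  have "l i0 j0 \<in> Span k0 Us" if i0: "i0 < k" "j0 < d" for i0 j0
  proof (rule ccontr)
    assume "l i0 j0 \<notin> Span k0 Us"
    from matching_exists[OF Us refl i0 this] obtain a b \<phi> L where ab: "a < k" "b < k"
      and not: "\<not> matched (Span k0 Us) (\<lambda>v. v) a b"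
      and \<phi>: "fixing_hom (Span k0 Us) \<phi>" "\<forall>v\<in>W. \<phi> v = \<zero> \<longrightarrow> v \<in> Span k0 L" "matched (Span k0 Us) \<phi> a b"
      and L: "set L \<subseteq> W" "length L \<le> k" by blast
    define r' where "r' = r((a, b) := Suc (r (a, b)))"
    have abP: "(a, b) \<in> P" using ab by (simp add: P_def)
    have sum: "(\<Sum>p\<in>P. r' p) = Suc (\<Sum>p\<in>P. r p)"
      using P abP unfolding r'_def by (simp add: sum.remove[of P "(a, b)"])
    obtain u where u: "u \<in> W - Span k0 Us" "count_forms a u \<noteq> count_forms b u"
      using not by (auto simp: matched_def)
    \<comment> \<open>The pair still has the unbalanced form \<open>u\<close>, so its power of two
      is bounded by an actual excess, and doubling it stays within \<open>4 * d\<close>.\<close>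
    have "2 ^ r (a, b) \<le> 2 * d"
      using r_excess[OF ab u] excess_le order_trans by blast
    then have r'_le: "2 ^ r' p \<le> 4 * d" if "p \<in> P" for p
      using r_le[OF that] by (auto simp: r'_def)
    have sub: "Span k0 Us \<subseteq> Span k0 (Us @ L)"
    proof
      fix x assume x: "x \<in> Span k0 Us"
      then have "x = x \<oplus> \<zero>" using Span_subset_W[OF Us] by auto
      then show "x \<in> Span k0 (Us @ L)"
        unfolding Span_append_iff[OF Us L(1)] using x Span_ops(1)[OF L(1)] by blast
    qed
    \<comment> \<open>The matched pair gains its factor by doubling; the other pairs keep their
      bounds because the excess is monotone in the span.\<close>
    have "2 ^ r' (a', b') \<le> excess (Span k0 (Us @ L)) a' b' u"
      if a'b': "a' < k" "b' < k" and u: "u \<in> W - Span k0 (Us @ L)" "count_forms a' u \<noteq> count_forms b' u"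
      for a' b' u
    proof (cases "(a', b') = (a, b)")
      case True
      then have "2 * 2 ^ r (a, b) \<le> excess (Span k0 (Us @ L)) a b u"
        using u r_excess[OF ab] by (intro excess_doubling[OF Us L(1) refl \<phi> ab]) auto
      then show ?thesis using True by (simp add: r'_def)
    next
      case False
      have "2 ^ r (a', b') \<le> excess (Span k0 Us) a' b' u"
        using r_excess[OF a'b' _ u(2)] u(1) sub by blast
      then show ?thesis using False excess_mono[OF sub, of a' b' u] by (auto simp: r'_def)
    qed
    then have "st (Us @ L, r')"
      using Us L len r'_le sum unfolding st_def by auto
    from s_max[OF this] show False using sum by simp
  qed
  moreover have "real (length Us) \<le> 3 * real k ^ 3 * log 2 (real d)"
  proof -
    \<comment> \<open>The factor 4 contributes \<open>log 2 4 = 2\<close>, which is at most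
      \<open>2 * log 2 (real d)\<close> as \<open>d\<close> is at least 2. Hence the constant
      3.\<close>
    have log1: "1 \<le> log 2 (real d)" using d by (simp add: le_log_iff)
    have "real (r p) \<le> 3 * log 2 (real d)" if "p \<in> P" for p
    proof -
      have "2 ^ r p \<le> 4 * real d" using r_le[OF that] by (metis of_nat_le_iff of_nat_mult of_nat_numeral of_nat_power)
      then have "real (r p) \<le> log 2 (4 * real d)"
        using d by (simp add: le_log_iff powr_realpow)
      also have "\<dots> = log 2 4 + log 2 (real d)" using d by (simp add: log_mult)
      also have "log 2 (4 :: real) = 2" using log_pow_cancel[of 2 2] by simp
      finally show ?thesis using log1 by simp
    qed
    then have "(\<Sum>p\<in>P. real (r p)) \<le> real (card P) * (3 * log 2 (real d))"
      by (rule sum_bounded_above)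
    then have "real k * (\<Sum>p\<in>P. real (r p)) \<le> real k * (real (card P) * (3 * log 2 (real d)))"
      by (intro mult_left_mono) auto
    also have "\<dots> = 3 * real k ^ 3 * log 2 (real d)"
      by (simp add: P power3_eq_cube)
    finally have "real k * (\<Sum>p\<in>P. real (r p)) \<le> 3 * real k ^ 3 * log 2 (real d)" .
    moreover have "real (length Us) \<le> real k * (\<Sum>p\<in>P. real (r p))"
      using len by (metis of_nat_le_iff of_nat_mult of_nat_sum)
    ultimately show ?thesis by simp
  qed
  ultimately show ?thesis using Us by blast
qed

end

section \<open>Linear forms as a vector space\<close>

lemma (in ring) dimension_Span_le:
  assumes K: "subfield K R" and "set Us \<subseteq> carrier R"
  shows "\<exists>n\<le>length Us. dimension n K (Span K Us)"
  using assms(2)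
proof (induction Us)
  case Nil
  then show ?case by auto
next
  case (Cons u Us)
  then obtain n where n: "n \<le> length Us" "dimension n K (Span K Us)" by auto
  show ?case
  proof (cases "u \<in> Span K Us")
    case True
    then have "Span K (u # Us) = Span K Us"
      using Span_base_incl[OF K] mono_Span_subset[OF K] Cons.prems
      by (metis insert_subset list.simps(15) subset_antisym)
    then show ?thesis using n by (metis le_SucI length_Cons)
  next
    case False
    have "dimension (Suc n) K (line_extension K u (Span K Us))"
      using Suc_dim[OF _ False n(2)] Cons.prems by auto
    then show ?thesis using n by (intro exI[of _ "Suc n"]) auto
  qed
qed

text \<open>An independent list with the span of \<open>Vs\<close> has the dimension as its length,
  and independent vectors in the span of \<open>Us\<close> cannot outnumber
  \<open>Us\<close>.\<close>

lemma (in ring) dim_Span_le: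
  assumes K: "subfield K R" and Us: "set Us \<subseteq> carrier R" and Vs: "set Vs \<subseteq> Span K Us"
  shows "dim K (Span K Vs) \<le> length Us"
proof -
  have "Span K Us \<subseteq> carrier R" using Span_subgroup_props(1)[OF K Us] .
  then have Vs_carrier: "set Vs \<subseteq> carrier R" using Vs by blast
  obtain Bs where Bs: "independent K Bs" "Span K Bs = Span K Vs"
    using filter_base[OF K Vs_carrier] by metis
  have "dim K (Span K Vs) = length Bs"
    using dimI[OF K dimension_independent[OF Bs(1)]] Bs(2) by (simp add: over_def)
  moreover have "set Bs \<subseteq> Span K Us"
    using Span_base_incl[OF K independent_in_carrier[OF Bs(1)]] mono_Span_subset[OF K Vs Us] Bs(2)
    by blast
  moreover obtain n where "n \<le> length Us" "dimension n K (Span K Us)"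
    using dimension_Span_le[OF K Us] by blast
  ultimately show ?thesis
    using independent_length_le_dimension[OF K _ Bs(1)] by fastforce
qed

section \<open>Polynomials and linear forms over a field\<close>

context field
begin

lemma indexed_const_ring_hom: "indexed_const \<in> ring_hom R (mpoly_ring R n)"
proof (rule ring_hom_memI)
  show "indexed_const (x \<otimes> y) =
      indexed_const x \<otimes>\<^bsub>mpoly_ring R n\<^esub> (indexed_const y :: nat multiset \<Rightarrow> 'a)"
    if "x \<in> carrier R" "y \<in> carrier R" for x y
    using that by (simp add: conv_const_left) (auto simp: indexed_const_def)
qed (auto simp: indexed_padd_const intro: indexed_pset.indexed_const)

lemma subfield_constants: "subfield (constants R) (mpoly_ring R n)"
proof -
  interpret M: domain "mpoly_ring R n" by (rule domain_mpoly_ring)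
  interpret h: ring_hom_ring R "mpoly_ring R n" indexed_const
    using ring_axioms M.ring_axioms indexed_const_ring_hom by (rule ring_hom_ringI2)
  show ?thesis
    unfolding constants_def by (rule h.img_is_subfield(2)[OF carrier_is_subfield M.one_not_zero])
qed

lemma mpoly_finsum_apply:
  assumes "P \<in> A \<rightarrow> carrier (mpoly_ring R n)"
  shows "(\<Oplus>\<^bsub>mpoly_ring R n\<^esub>i\<in>A. P i) m = (\<Oplus>i\<in>A. P i m)"
proof -
  interpret M: domain "mpoly_ring R n" by (rule domain_mpoly_ring)
  show ?thesis
    using assms
  proof (induction A rule: infinite_finite_induct)
    case (insert a A)
    then have "P a m \<in> carrier R" "(\<lambda>i. P i m) \<in> A \<rightarrow> carrier R"
      by (auto simp: Pi_iff)
    then show ?case using insert by (simp add: indexed_padd_def)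
  qed (auto simp: indexed_zero_def)
qed

definition linear_form :: "nat \<Rightarrow> (nat \<Rightarrow> 'a) \<Rightarrow> nat multiset \<Rightarrow> 'a" where
  "linear_form n a =
    (\<Oplus>\<^bsub>mpoly_ring R n\<^esub>i\<in>{..<n}. indexed_const (a i) \<otimes>\<^bsub>mpoly_ring R n\<^esub> indexed_var i)"

lemma linear_forms_eq: "linear_forms R n = linear_form n ` ({..<n} \<rightarrow> carrier R)"
  by (auto simp: linear_forms_def linear_form_def)

lemma linear_formsE:
  assumes "v \<in> linear_forms R n"
  obtains a where "a \<in> {..<n} \<rightarrow> carrier R" "v = linear_form n a"
  using assms unfolding linear_forms_eq by (rule imageE)

lemma indexed_var_closed: "i < n \<Longrightarrow> indexed_var i \<in> indexed_pset {..<n} (carrier R)"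
  unfolding indexed_var_def by (intro indexed_pset.indexed_pmult indexed_pset.indexed_const) auto

lemma indexed_var_apply: "indexed_var i m = (if m = {#i#} then \<one> else \<zero>)"
  by (auto simp: indexed_var_def indexed_pmult_def indexed_const_def dest: multi_member_split)

lemma linear_form_summand:
  assumes "k \<in> carrier R"
  shows "conv (indexed_const k) (indexed_var i) = (\<lambda>m. if m = {#i#} then k else \<zero>)"
proof -
  have "carrier_coeff (indexed_var i)" by (simp add: indexed_var_def)
  then show ?thesis using assms by (auto simp: conv_const_left indexed_var_apply)
qed

lemma linear_form_closed: "a \<in> {..<n} \<rightarrow> carrier R \<Longrightarrow> linear_form n a \<in> carrier (mpoly_ring R n)"
proof -
  interpret M: domain "mpoly_ring R n" by (rule domain_mpoly_ring)
  assume "a \<in> {..<n} \<rightarrow> carrier R"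
  then show ?thesis
    unfolding linear_form_def
    by (intro M.finsum_closed funcsetI M.m_closed)
      (auto simp: indexed_var_closed intro: indexed_pset.indexed_const)
qed

text \<open>The description operator recovers the variable from a singleton monomial. With this
  formula, identities between linear forms are checked coefficientwise.\<close>

lemma linear_form_apply:
  assumes a: "a \<in> {..<n} \<rightarrow> carrier R"
  shows "linear_form n a m = (if \<exists>i<n. m = {#i#} then a (THE i. m = {#i#}) else \<zero>)"
proof -
  have "linear_form n a m = (\<Oplus>i\<in>{..<n}. (\<lambda>m. if m = {#i#} then a i else \<zero>) m)"
    unfolding linear_form_def
  proof (subst mpoly_finsum_apply)
    show "(\<lambda>i. indexed_const (a i) \<otimes>\<^bsub>mpoly_ring R n\<^esub> indexed_var i) \<in> {..<n} \<rightarrow> carrier (mpoly_ring R n)"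
      using a by (auto intro!: conv_in_pset indexed_var_closed indexed_pset.indexed_const)
    show "(\<Oplus>i\<in>{..<n}. (indexed_const (a i) \<otimes>\<^bsub>mpoly_ring R n\<^esub> indexed_var i) m) =
        (\<Oplus>i\<in>{..<n}. if m = {#i#} then a i else \<zero>)"
      by (rule add.finprod_cong') (use a in \<open>auto simp: linear_form_summand Pi_iff\<close>)
  qed
  also have "\<dots> = (if \<exists>i<n. m = {#i#} then a (THE i. m = {#i#}) else \<zero>)"
  proof (cases "\<exists>i<n. m = {#i#}")
    case True
    then obtain i where i: "i < n" "m = {#i#}" by blast
    have "(\<Oplus>j\<in>{..<n}. if m = {#j#} then a j else \<zero>) = (\<Oplus>j\<in>{..<n}. if i = j then a j else \<zero>)"
      using i by (intro add.finprod_cong') (use a in auto)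
    also have "\<dots> = a i" using i a by (intro add.finprod_singleton) auto
    finally show ?thesis using i by auto
  next
    case False
    then have "(\<Oplus>j\<in>{..<n}. if m = {#j#} then a j else \<zero>) = (\<Oplus>j\<in>{..<n}. \<zero>)"
      by (intro add.finprod_cong') auto
    then show ?thesis using False by auto
  qed
  finally show ?thesis .
qed

lemma linear_form_coeff: "a \<in> {..<n} \<rightarrow> carrier R \<Longrightarrow> i < n \<Longrightarrow> linear_form n a {#i#} = a i"
  by (auto simp: linear_form_apply)

lemma linear_form_add:
  assumes "a \<in> {..<n} \<rightarrow> carrier R" "b \<in> {..<n} \<rightarrow> carrier R"
  shows "indexed_padd (linear_form n a) (linear_form n b) = linear_form n (\<lambda>i. a i \<oplus> b i)"
proof
  fix m
  have "(\<lambda>i. a i \<oplus> b i) \<in> {..<n} \<rightarrow> carrier R" using assms by auto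
  then show "indexed_padd (linear_form n a) (linear_form n b) m = linear_form n (\<lambda>i. a i \<oplus> b i) m"
    using assms by (cases "\<exists>i<n. m = {#i#}") (auto simp: linear_form_apply indexed_padd_def)
qed

lemma linear_form_scale:
  assumes "a \<in> {..<n} \<rightarrow> carrier R" "c \<in> carrier R"
  shows "conv (indexed_const c) (linear_form n a) = linear_form n (\<lambda>i. c \<otimes> a i)"
proof
  fix m
  have "(\<lambda>i. c \<otimes> a i) \<in> {..<n} \<rightarrow> carrier R" using assms by auto
  moreover have "carrier_coeff (linear_form n a)"
    using linear_form_closed[OF assms(1)] by simp
  ultimately show "conv (indexed_const c) (linear_form n a) m = linear_form n (\<lambda>i. c \<otimes> a i) m"
    using assms by (cases "\<exists>i<n. m = {#i#}") (auto simp: linear_form_apply conv_const_left)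
qed

lemma linear_form_zero: "linear_form n (\<lambda>_. \<zero>) = indexed_const \<zero>"
  by (auto simp: linear_form_apply indexed_zero_def)

lemma indexed_var_linear_form:
  assumes "i < n"
  shows "indexed_var i = linear_form n (\<lambda>j. if j = i then \<one> else \<zero>)"
proof -
  have "indexed_var i m = linear_form n (\<lambda>j. if j = i then \<one> else \<zero>) m" for m
    using assms by (cases "\<exists>i<n. m = {#i#}") (auto simp: linear_form_apply indexed_var_apply)
  then show ?thesis by auto
qed

text \<open>Two axioms carry content: extracting the coefficient of a variable that occurs in
  \<open>w\<close> gives the functional, and evaluating the variables gives the
  substitution.\<close>

lemma form_ring_mpoly_ring: "form_ring (mpoly_ring R n) (constants R) (linear_forms R n)"
proof -
  interpret M: domain "mpoly_ring R n" by (rule domain_mpoly_ring)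
  let ?M = "mpoly_ring R n" and ?k0 = "constants R" and ?W = "linear_forms R n"
  have W_carrier: "?W \<subseteq> carrier ?M" using linear_form_closed by (auto simp: linear_forms_eq)
  have W_zero: "\<zero>\<^bsub>?M\<^esub> \<in> ?W"
    unfolding linear_forms_eq using linear_form_zero[of n]
    by (intro image_eqI[of _ _ "\<lambda>_. \<zero>"]) auto
  have W_add: "v \<oplus>\<^bsub>?M\<^esub> w \<in> ?W" if vw: "v \<in> ?W" "w \<in> ?W" for v w
  proof -
    obtain a where a: "a \<in> {..<n} \<rightarrow> carrier R" "v = linear_form n a"
      using vw(1) by (rule linear_formsE)
    obtain b where b: "b \<in> {..<n} \<rightarrow> carrier R" "w = linear_form n b"
      using vw(2) by (rule linear_formsE)
    show ?thesis unfolding linear_forms_eq using a b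
      by (intro image_eqI[of _ _ "\<lambda>i. a i \<oplus> b i"]) (auto simp: linear_form_add)
  qed
  have W_smult: "c \<otimes>\<^bsub>?M\<^esub> v \<in> ?W" if cv: "c \<in> ?k0" "v \<in> ?W" for c v
  proof -
    obtain k where k: "k \<in> carrier R" "c = indexed_const k"
      using cv(1) unfolding constants_def by blast
    obtain a where a: "a \<in> {..<n} \<rightarrow> carrier R" "v = linear_form n a"
      using cv(2) by (rule linear_formsE)
    show ?thesis unfolding linear_forms_eq using k a
      by (intro image_eqI[of _ _ "\<lambda>i. k \<otimes> a i"]) (auto simp: linear_form_scale)
  qed
  have var_W: "indexed_var i \<in> ?W" if "i < n" for i
    unfolding linear_forms_eq indexed_var_linear_form[OF that] by (intro imageI) auto
  have const_k0: "indexed_const k \<in> ?k0" if "k \<in> carrier R" for k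
    using that by (auto simp: constants_def)
  have k0_carrier: "?k0 \<subseteq> carrier ?M" using subfieldE(3)[OF subfield_constants] .
  show ?thesis
  proof (intro form_ring.intro domain_mpoly_ring form_ring_axioms.intro)
    show "subfield ?k0 ?M" by (rule subfield_constants)
    show "?W \<subseteq> carrier ?M" "\<zero>\<^bsub>?M\<^esub> \<in> ?W" by fact+
    show "\<And>v w. v \<in> ?W \<Longrightarrow> w \<in> ?W \<Longrightarrow> v \<oplus>\<^bsub>?M\<^esub> w \<in> ?W" by (rule W_add)
    show "\<And>c v. c \<in> ?k0 \<Longrightarrow> v \<in> ?W \<Longrightarrow> c \<otimes>\<^bsub>?M\<^esub> v \<in> ?W" by (rule W_smult)
  next
    fix w assume "w \<in> ?W" "w \<noteq> \<zero>\<^bsub>?M\<^esub>"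
    then obtain b where b: "b \<in> {..<n} \<rightarrow> carrier R" "w = linear_form n b" using linear_formsE by blast
    have "\<exists>i<n. b i \<noteq> \<zero>"
    proof (rule ccontr)
      assume "\<not> ?thesis"
      then have "linear_form n b m = linear_form n (\<lambda>_. \<zero>) m" for m
        using b(1) by (auto simp: linear_form_apply)
      then show False using \<open>w \<noteq> \<zero>\<^bsub>?M\<^esub>\<close> b(2) linear_form_zero by (auto simp: fun_eq_iff)
    qed
    then obtain i where i: "i < n" "b i \<noteq> \<zero>" by blast
    define f :: "(nat multiset \<Rightarrow> 'a) \<Rightarrow> nat multiset \<Rightarrow> 'a"
      where "f v = indexed_const (v {#i#})" for v
    have "M.linear_functional ?k0 ?W f"
      unfolding M.linear_functional_def
    proof (intro conjI ballI)
      show "f \<in> ?W \<rightarrow> ?k0" using W_carrier unfolding f_def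
        by (intro funcsetI const_k0 carrier_coeffD indexed_pset_carrier_coeff) auto
      show "f (v \<oplus>\<^bsub>?M\<^esub> w) = f v \<oplus>\<^bsub>?M\<^esub> f w" if "v \<in> ?W" "w \<in> ?W" for v w
        by (simp add: f_def indexed_padd_const) (simp add: indexed_padd_def)
      show "f (c \<otimes>\<^bsub>?M\<^esub> v) = c \<otimes>\<^bsub>?M\<^esub> f v" if cv: "c \<in> ?k0" "v \<in> ?W" for c v
      proof -
        obtain k where k: "k \<in> carrier R" "c = indexed_const k" using cv by (auto simp: constants_def)
        have v: "carrier_coeff v" using cv W_carrier by auto
        show ?thesis using k v
          by (simp add: f_def conv_const_left) (auto simp: indexed_const_def)
      qed
    qed
    moreover have "f w \<noteq> \<zero>\<^bsub>?M\<^esub>"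
      using i b linear_form_coeff by (auto simp: f_def indexed_const_def fun_eq_iff)
    ultimately show "\<exists>f. M.linear_functional ?k0 ?W f \<and> f w \<noteq> \<zero>\<^bsub>?M\<^esub>" by blast
  next
    fix f w assume f: "M.linear_functional ?k0 ?W f" and w: "w \<in> ?W"
    have fD: "v \<in> ?W \<Longrightarrow> f v \<in> ?k0" "v \<in> ?W \<Longrightarrow> w \<in> ?W \<Longrightarrow> f (v \<oplus>\<^bsub>?M\<^esub> w) = f v \<oplus>\<^bsub>?M\<^esub> f w"
      "c \<in> ?k0 \<Longrightarrow> v \<in> ?W \<Longrightarrow> f (c \<otimes>\<^bsub>?M\<^esub> v) = c \<otimes>\<^bsub>?M\<^esub> f v" for v w c
      using f by (auto simp: M.linear_functional_def)
    \<comment> \<open>The value that the required formula for \<open>\<sigma>\<close> forces on a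
      variable.\<close>
    define s where "s i = indexed_var i \<ominus>\<^bsub>?M\<^esub> f (indexed_var i) \<otimes>\<^bsub>?M\<^esub> w" for i
    have fc: "v \<in> ?W \<Longrightarrow> f v \<in> carrier ?M" for v using fD(1) k0_carrier by blast
    have Wc: "v \<in> ?W \<Longrightarrow> v \<in> carrier ?M" for v using W_carrier by blast
    have s_closed: "s i \<in> carrier ?M" if "i < n" for i
      unfolding s_def using fc[OF var_W[OF that]] Wc[OF var_W[OF that]] Wc[OF w]
      by (intro M.minus_closed M.m_closed)
    obtain \<sigma> where \<sigma>: "\<sigma> \<in> ring_hom ?M ?M" "\<forall>k\<in>carrier R. \<sigma> (indexed_const k) = indexed_const k"
      "\<forall>i<n. \<sigma> (indexed_var i) = s i"
      using mpoly_evaluation[OF M.is_cring indexed_const_ring_hom, where s = s and n = n] s_closed by blast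
    interpret \<sigma>: ring_hom_cring ?M ?M \<sigma>
      using \<sigma>(1) M.is_cring by (simp add: ring_hom_cring_def ring_hom_cring_axioms_def)
    have f0: "f \<zero>\<^bsub>?M\<^esub> = \<zero>\<^bsub>?M\<^esub>"
    proof -
      have "f \<zero>\<^bsub>?M\<^esub> \<oplus>\<^bsub>?M\<^esub> f \<zero>\<^bsub>?M\<^esub> = f \<zero>\<^bsub>?M\<^esub>"
        using fD(2)[OF W_zero W_zero] M.l_zero[OF M.zero_closed] by simp
      then show ?thesis using fc[OF W_zero] M.add.r_cancel_one by metis
    qed
    \<comment> \<open>Both sides are linear in the form, so agreement on the variables suffices.
      Membership in \<open>W\<close> is carried along because \<open>f\<close> is linear only
      there.\<close>
    have step: "(\<Oplus>\<^bsub>?M\<^esub>i\<in>A. indexed_const (a i) \<otimes>\<^bsub>?M\<^esub> indexed_var i) \<in> ?W \<and>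
        \<sigma> (\<Oplus>\<^bsub>?M\<^esub>i\<in>A. indexed_const (a i) \<otimes>\<^bsub>?M\<^esub> indexed_var i) =
          (\<Oplus>\<^bsub>?M\<^esub>i\<in>A. indexed_const (a i) \<otimes>\<^bsub>?M\<^esub> indexed_var i) \<ominus>\<^bsub>?M\<^esub>
          f (\<Oplus>\<^bsub>?M\<^esub>i\<in>A. indexed_const (a i) \<otimes>\<^bsub>?M\<^esub> indexed_var i) \<otimes>\<^bsub>?M\<^esub> w"
      if "finite A" "A \<subseteq> {..<n}" "a \<in> {..<n} \<rightarrow> carrier R" for A a
      using that(1,2)
    proof (induction A rule: finite_induct)
      case empty
      have "\<zero>\<^bsub>?M\<^esub> \<ominus>\<^bsub>?M\<^esub> \<zero>\<^bsub>?M\<^esub> = \<zero>\<^bsub>?M\<^esub>"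
        by (simp only: M.r_right_minus_eq M.zero_closed)
      then show ?case using W_zero f0 M.l_null[OF Wc[OF w]] \<sigma>.hom_zero
        by (simp only: M.finsum_empty simp_thms)
    next
      case (insert i A)
      define p where "p = (\<Oplus>\<^bsub>?M\<^esub>i\<in>A. indexed_const (a i) \<otimes>\<^bsub>?M\<^esub> indexed_var i)"
      define x where "x = indexed_var i"
      define c :: "nat multiset \<Rightarrow> 'a" where "c = indexed_const (a i)"
      have i: "i < n" "a i \<in> carrier R" using insert that(3) by auto
      have c: "c \<in> ?k0" "c \<in> carrier ?M" "\<sigma> c = c"
        using const_k0 i k0_carrier \<sigma>(2) by (auto simp: c_def)
      have x: "x \<in> ?W" "x \<in> carrier ?M" "f x \<in> carrier ?M" "\<sigma> x = x \<ominus>\<^bsub>?M\<^esub> f x \<otimes>\<^bsub>?M\<^esub> w"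
        using var_W Wc fc \<sigma>(3) i by (auto simp: x_def s_def)
      have p: "p \<in> ?W" "p \<in> carrier ?M" "f p \<in> carrier ?M" "\<sigma> p = p \<ominus>\<^bsub>?M\<^esub> f p \<otimes>\<^bsub>?M\<^esub> w"
        using insert Wc fc by (auto simp: p_def)
      have eq: "(\<Oplus>\<^bsub>?M\<^esub>i\<in>insert i A. indexed_const (a i) \<otimes>\<^bsub>?M\<^esub> indexed_var i) = c \<otimes>\<^bsub>?M\<^esub> x \<oplus>\<^bsub>?M\<^esub> p"
        unfolding p_def c_def x_def
      proof (rule M.finsum_insert)
        show "(\<lambda>i. indexed_const (a i) \<otimes>\<^bsub>?M\<^esub> indexed_var i) \<in> A \<rightarrow> carrier ?M"
          using insert.prems that(3) Wc W_smult const_k0 var_W by (intro funcsetI) (meson Pi_mem lessThan_iff insert_subset subsetD)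
        show "indexed_const (a i) \<otimes>\<^bsub>?M\<^esub> indexed_var i \<in> carrier ?M"
          using M.m_closed[OF c(2) x(2)] by (simp only: c_def x_def)
      qed (use insert in auto)
      have cx: "c \<otimes>\<^bsub>?M\<^esub> x \<in> ?W" using W_smult c x by blast
      have fcx: "f (c \<otimes>\<^bsub>?M\<^esub> x \<oplus>\<^bsub>?M\<^esub> p) = c \<otimes>\<^bsub>?M\<^esub> f x \<oplus>\<^bsub>?M\<^esub> f p"
        using fD(2)[OF cx p(1)] fD(3)[OF c(1) x(1)] by simp
      have "\<sigma> (c \<otimes>\<^bsub>?M\<^esub> x \<oplus>\<^bsub>?M\<^esub> p) = c \<otimes>\<^bsub>?M\<^esub> \<sigma> x \<oplus>\<^bsub>?M\<^esub> \<sigma> p"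
        using c(2,3) x(2) p(2) Wc[OF cx] \<sigma>.hom_add \<sigma>.hom_mult by metis
      also have "\<dots> = (c \<otimes>\<^bsub>?M\<^esub> x \<oplus>\<^bsub>?M\<^esub> p) \<ominus>\<^bsub>?M\<^esub> (c \<otimes>\<^bsub>?M\<^esub> f x \<oplus>\<^bsub>?M\<^esub> f p) \<otimes>\<^bsub>?M\<^esub> w"
        unfolding x(4) p(4) using c(2) x(2,3) p(2,3) Wc[OF w]
        by (simp del: mpoly_ring_simps add: M.r_distr M.l_distr M.m_assoc M.r_minus M.a_ac M.minus_add
            a_minus_def)
      finally show ?case unfolding eq fcx using W_add[OF cx p(1)] by blast
    qed
    have "\<sigma> v = v \<ominus>\<^bsub>?M\<^esub> f v \<otimes>\<^bsub>?M\<^esub> w" if v: "v \<in> ?W" for v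
    proof -
      obtain a where "a \<in> {..<n} \<rightarrow> carrier R" "v = linear_form n a"
        using v by (rule linear_formsE)
      then show ?thesis using step[of "{..<n}" a] unfolding linear_form_def by blast
    qed
    moreover have "\<forall>c\<in>?k0. \<sigma> c = c" using \<sigma>(2) by (auto simp: constants_def)
    ultimately show "\<exists>\<sigma>\<in>ring_hom ?M ?M. (\<forall>c\<in>?k0. \<sigma> c = c) \<and>
        (\<forall>v\<in>?W. \<sigma> v = v \<ominus>\<^bsub>?M\<^esub> f v \<otimes>\<^bsub>?M\<^esub> w)"
      using \<sigma>(1) by blast
  qed
qed

theorem rank_bound_three: "rank_bound R 3"
  unfolding rank_bound_def
proof (intro allI impI)
  fix n k d \<alpha> l
  assume d: "2 \<le> d" and C: "depth3_circuit R n k d \<alpha> l" and simple: "simple_circuit R n k d \<alpha> l"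
    and minimal: "minimal_circuit R n k d \<alpha> l" and identity: "identity_circuit R n k d \<alpha> l"
  let ?M = "mpoly_ring R n"
  interpret Z: form_ring ?M "constants R" "linear_forms R n" by (rule form_ring_mpoly_ring)
  interpret Z: zero_circuit ?M "constants R" "linear_forms R n" k d l "\<lambda>i. indexed_const (\<alpha> i)"
  proof
    show "l i j \<in> linear_forms R n" if "i < k" "j < d" for i j
      using C that by (auto simp: depth3_circuit_def)
    show "indexed_const (\<alpha> i) \<in> constants R - {\<zero>\<^bsub>?M\<^esub>}" if "i < k" for i
      using C that by (auto simp: depth3_circuit_def constants_def indexed_const_def fun_eq_iff)
    show "(\<Oplus>\<^bsub>?M\<^esub>i\<in>{..<k}. indexed_const (\<alpha> i) \<otimes>\<^bsub>?M\<^esub> (\<Otimes>\<^bsub>?M\<^esub>j\<in>{..<d}. l i j)) = \<zero>\<^bsub>?M\<^esub>"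
      using identity by (simp only: identity_circuit_def mult_term_def)
    show "(\<Oplus>\<^bsub>?M\<^esub>i\<in>S. indexed_const (\<alpha> i) \<otimes>\<^bsub>?M\<^esub> (\<Otimes>\<^bsub>?M\<^esub>j\<in>{..<d}. l i j)) \<noteq> \<zero>\<^bsub>?M\<^esub>"
      if "S \<subset> {..<k}" "S \<noteq> {}" for S
      using minimal that unfolding minimal_circuit_def mult_term_def by blast
    show "\<exists>i<k. \<not> u divides\<^bsub>?M\<^esub> indexed_const (\<alpha> i) \<otimes>\<^bsub>?M\<^esub> (\<Otimes>\<^bsub>?M\<^esub>j\<in>{..<d}. l i j)"
      if "u \<in> linear_forms R n" "u \<noteq> \<zero>\<^bsub>?M\<^esub>" for u
      using simple that unfolding simple_circuit_def mult_term_def by blast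
  qed
  obtain Us where Us: "set Us \<subseteq> linear_forms R n"
    "\<forall>i<k. \<forall>j<d. l i j \<in> Z.Span (constants R) Us"
    "real (length Us) \<le> 3 * real k ^ 3 * log 2 (real d)"
    using Z.spanning_list[OF d] by blast
  have "circuit_rank R n k d l \<le> length Us"
    unfolding circuit_rank_def using Us(2)
    by (intro Z.dim_Span_le[OF Z.k0 Z.list_W_carrier[OF Us(1)]]) auto
  then show "real (circuit_rank R n k d l) \<le> 3 * real k ^ 3 * log 2 (real d)"
    using Us(3) by linarith
qed

end

section \<open>Descent to a countable subfield\<close>

text \<open>Names for the elements of a generated field, whose countability is inherited from this
  type.\<close>

datatype field_expr = One | Generator nat | Neg field_expr | Inv field_expr
  | Plus field_expr field_expr | Times field_expr field_expr

instance field_expr :: countable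
  by countable_datatype

primrec field_expr_value :: "('a, 'b) ring_scheme \<Rightarrow> (nat \<Rightarrow> 'a) \<Rightarrow> field_expr \<Rightarrow> 'a" where
  "field_expr_value R v One = \<one>\<^bsub>R\<^esub>"
| "field_expr_value R v (Generator i) = v i"
| "field_expr_value R v (Neg s) = \<ominus>\<^bsub>R\<^esub> field_expr_value R v s"
| "field_expr_value R v (Inv s) = inv\<^bsub>R\<^esub> field_expr_value R v s"
| "field_expr_value R v (Plus s t) = field_expr_value R v s \<oplus>\<^bsub>R\<^esub> field_expr_value R v t"
| "field_expr_value R v (Times s t) = field_expr_value R v s \<otimes>\<^bsub>R\<^esub> field_expr_value R v t"

lemma countable_generate_field:
  fixes R :: "('a, 'b) ring_scheme" and H :: "'a set"
  assumes "countable H"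
  shows "countable (generate_field R H)"
proof -
  \<comment> \<open>For empty \<open>H\<close> the generators get an arbitrary value, which can only
    enlarge the range that has to cover the field.\<close>
  define val where "val = field_expr_value R (from_nat_into H)"
  have "\<exists>s. x = val s" if "x \<in> generate_field R H" for x
    using that
  proof (induction)
    case one
    show ?case by (rule exI[of _ One]) (simp add: val_def)
  next
    case (incl h)
    then obtain i where "from_nat_into H i = h" using from_nat_into_surj[OF assms] by blast
    then show ?case by (intro exI[of _ "Generator i"]) (simp add: val_def)
  next
    case (a_inv h)
    then obtain s where "h = val s" by blast
    then show ?case by (intro exI[of _ "Neg s"]) (simp add: val_def)
  next
    case (m_inv h)
    then obtain s where "h = val s" by blast
    then show ?case by (intro exI[of _ "Inv s"]) (simp add: val_def)
  next
    case (eng_add h1 h2)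
    then obtain s t where "h1 = val s" "h2 = val t" by blast
    then show ?case by (intro exI[of _ "Plus s t"]) (simp add: val_def)
  next
    case (eng_mult h1 h2)
    then obtain s t where "h1 = val s" "h2 = val t" by blast
    then show ?case by (intro exI[of _ "Times s t"]) (simp add: val_def)
  qed
  then have "generate_field R H \<subseteq> range val" by auto
  moreover have "countable (range val)" by (intro countable_image countableI_type)
  ultimately show ?thesis by (rule countable_subset)
qed

lemma (in ring) Span_mono_field: "K \<subseteq> K' \<Longrightarrow> Span K Us \<subseteq> Span K' Us"
proof (induction Us)
  case (Cons u Us)
  then show ?case by (auto simp: line_extension_mem_iff) blast
qed simp

section \<open>Transfer of circuits along field embeddings\<close>

locale field_embedding = A: field A + B: field B
  for A :: "('a, 'c) ring_scheme" and B :: "('b, 'd) ring_scheme" +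
  fixes g :: "'a \<Rightarrow> 'b"
  assumes hom: "g \<in> ring_hom A B"
begin

lemma g_cring: "ring_hom_cring A B g"
  using A.is_cring B.is_cring hom by (simp add: ring_hom_cring_def ring_hom_cring_axioms_def)

lemma g_simps [simp]:
  "x \<in> carrier A \<Longrightarrow> g x \<in> carrier B" "g \<zero>\<^bsub>A\<^esub> = \<zero>\<^bsub>B\<^esub>" "g \<one>\<^bsub>A\<^esub> = \<one>\<^bsub>B\<^esub>"
  "x \<in> carrier A \<Longrightarrow> y \<in> carrier A \<Longrightarrow> g (x \<oplus>\<^bsub>A\<^esub> y) = g x \<oplus>\<^bsub>B\<^esub> g y"
  "x \<in> carrier A \<Longrightarrow> y \<in> carrier A \<Longrightarrow> g (x \<otimes>\<^bsub>A\<^esub> y) = g x \<otimes>\<^bsub>B\<^esub> g y"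
proof -
  interpret g: ring_hom_cring A B g by (rule g_cring)
  show "x \<in> carrier A \<Longrightarrow> g x \<in> carrier B" "g \<zero>\<^bsub>A\<^esub> = \<zero>\<^bsub>B\<^esub>" "g \<one>\<^bsub>A\<^esub> = \<one>\<^bsub>B\<^esub>"
    "x \<in> carrier A \<Longrightarrow> y \<in> carrier A \<Longrightarrow> g (x \<oplus>\<^bsub>A\<^esub> y) = g x \<oplus>\<^bsub>B\<^esub> g y"
    "x \<in> carrier A \<Longrightarrow> y \<in> carrier A \<Longrightarrow> g (x \<otimes>\<^bsub>A\<^esub> y) = g x \<otimes>\<^bsub>B\<^esub> g y"
    by simp_all
qed

lemma g_inj: "inj_on g (carrier A)"
proof -
  interpret g: ring_hom_ring A B g using g_cring by (simp add: ring_hom_ringI2 A.ring_axioms B.ring_axioms hom)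
  show ?thesis using g.img_is_subfield(1)[OF A.carrier_is_subfield] B.one_not_zero by simp
qed

lemma map_const: "g \<circ> A.indexed_const k = B.indexed_const (g k)"
  by (auto simp: A.indexed_const_def B.indexed_const_def)

lemma map_padd:
  assumes "A.carrier_coeff P" "A.carrier_coeff Q"
  shows "g \<circ> A.indexed_padd P Q = B.indexed_padd (g \<circ> P) (g \<circ> Q)"
  using assms by (auto simp: A.indexed_padd_def B.indexed_padd_def)

lemma map_pmult: "g \<circ> A.indexed_pmult P i = B.indexed_pmult (g \<circ> P) i"
  by (auto simp: A.indexed_pmult_def B.indexed_pmult_def)

lemma map_in_pset:
  "P \<in> A.indexed_pset I (carrier A) \<Longrightarrow> g \<circ> P \<in> B.indexed_pset I (carrier B)"
proof (induction rule: A.indexed_pset.induct)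
  case (indexed_const k)
  then show ?case unfolding map_const by (intro B.indexed_pset.indexed_const g_simps(1))
next
  case (indexed_padd P Q)
  then show ?case
    using B.indexed_pset.indexed_padd[OF indexed_padd.IH] by (simp only: map_padd A.indexed_pset_carrier_coeff)
next
  case (indexed_pmult P i)
  then show ?case
    using B.indexed_pset.indexed_pmult[OF indexed_pmult.IH] by (simp only: map_pmult)
qed

lemma map_conv:
  assumes "A.carrier_coeff P" "A.carrier_coeff Q"
  shows "g \<circ> A.conv P Q = B.conv (g \<circ> P) (g \<circ> Q)"
proof
  fix m
  interpret g: ring_hom_cring A B g by (rule g_cring)
  have "g (A.conv P Q m) = (\<Oplus>\<^bsub>B\<^esub>M\<in>{M. M \<subseteq># m}. (g \<circ> (\<lambda>M. P M \<otimes>\<^bsub>A\<^esub> Q (m - M))) M)"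
    unfolding A.conv_def using assms by (intro g.hom_finsum) auto
  also have "\<dots> = B.conv (g \<circ> P) (g \<circ> Q) m"
    unfolding B.conv_def using assms by (intro B.add.finprod_cong') auto
  finally show "(g \<circ> A.conv P Q) m = B.conv (g \<circ> P) (g \<circ> Q) m" by simp
qed

lemma map_mpoly_hom: "(\<lambda>P. g \<circ> P) \<in> ring_hom (mpoly_ring A n) (mpoly_ring B n)"
  by (rule ring_hom_memI) (simp_all add: map_in_pset map_conv map_padd map_const)

lemma map_mpoly_inj: "inj_on (\<lambda>P. g \<circ> P) (carrier (mpoly_ring A n))"
proof (rule inj_onI)
  fix P Q assume "P \<in> carrier (mpoly_ring A n)" "Q \<in> carrier (mpoly_ring A n)" "g \<circ> P = g \<circ> Q"
  then have "P m = Q m" for m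
    using inj_onD[OF g_inj, of "P m" "Q m"] by (auto simp: fun_eq_iff)
  then show "P = Q" by auto
qed

lemma map_linear_form:
  assumes "a \<in> {..<n} \<rightarrow> carrier A"
  shows "g \<circ> A.linear_form n a = B.linear_form n (g \<circ> a)"
proof -
  have "g \<circ> a \<in> {..<n} \<rightarrow> carrier B" using assms by (auto simp: Pi_iff)
  then show ?thesis using assms
    by (auto simp: A.linear_form_apply B.linear_form_apply fun_eq_iff)
qed

lemma map_linear_forms: "v \<in> linear_forms A n \<Longrightarrow> g \<circ> v \<in> linear_forms B n"
  by (erule A.linear_formsE) (auto simp: B.linear_forms_eq map_linear_form Pi_iff intro!: imageI)

lemma map_constants: "(\<lambda>P. g \<circ> P) ` constants A \<subseteq> constants B"
  by (auto simp: constants_def map_const)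

text \<open>A basis of the span of the forms over \<open>A\<close> maps to a list over
  \<open>B\<close> whose span contains their images. This direction carries a rank bound from
  \<open>A\<close> to \<open>B\<close>.\<close>

lemma circuit_rank_map:
  assumes C: "depth3_circuit A n k d \<alpha> l"
    and l': "\<And>i j. i < k \<Longrightarrow> j < d \<Longrightarrow> l' i j = g \<circ> l i j"
  shows "circuit_rank B n k d l' \<le> circuit_rank A n k d l"
proof -
  let ?A = "mpoly_ring A n" and ?B = "mpoly_ring B n" and ?G = "\<lambda>P. g \<circ> P"
  interpret MA: domain ?A by (rule A.domain_mpoly_ring)
  interpret MB: domain ?B by (rule B.domain_mpoly_ring)
  interpret G: ring_hom_ring ?A ?B ?G
    using MA.ring_axioms MB.ring_axioms map_mpoly_hom by (rule ring_hom_ringI2)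
  note kA = A.subfield_constants[of n] and kB = B.subfield_constants[of n]
  define xs where "xs = [l i j. i \<leftarrow> [0..<k], j \<leftarrow> [0..<d]]"
  define ys where "ys = [l' i j. i \<leftarrow> [0..<k], j \<leftarrow> [0..<d]]"
  have ys: "set ys = ?G ` set xs"
    unfolding xs_def ys_def using l' by (force simp: image_iff)
  have "linear_forms A n \<subseteq> carrier ?A"
    unfolding A.linear_forms_eq using A.linear_form_closed by blast
  then have xs: "set xs \<subseteq> carrier ?A"
    using C unfolding xs_def depth3_circuit_def by auto
  obtain Vs where Vs: "set Vs \<subseteq> carrier ?A" "MA.independent (constants A) Vs"
    "MA.Span (constants A) Vs = MA.Span (constants A) xs"
    using MA.filter_base[OF kA xs] by blast
  have rank: "circuit_rank A n k d l = length Vs"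
    unfolding circuit_rank_def xs_def[symmetric]
    using MA.dimI[OF kA MA.dimension_independent[OF Vs(2)]] Vs(3) by (simp add: over_def)
  have "set xs \<subseteq> MA.Span (constants A) Vs"
    using MA.Span_base_incl[OF kA xs] Vs(3) by simp
  then have "set ys \<subseteq> ?G ` MA.Span (constants A) Vs" unfolding ys by blast
  also have "\<dots> = MB.Span (?G ` constants A) (map ?G Vs)"
    using G.Span_hom[OF subfieldE(3)[OF kA] Vs(1)] by simp
  also have "\<dots> \<subseteq> MB.Span (constants B) (map ?G Vs)"
    by (rule MB.Span_mono_field[OF map_constants])
  finally have "set ys \<subseteq> MB.Span (constants B) (map ?G Vs)" .
  moreover have "set (map ?G Vs) \<subseteq> carrier ?B" using Vs(1) G.hom_closed by auto
  ultimately have "MB.dim (constants B) (MB.Span (constants B) ys) \<le> length (map ?G Vs)"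
    by (intro MB.dim_Span_le[OF kB])
  then show ?thesis
    unfolding rank length_map unfolding circuit_rank_def ys_def[symmetric] .
qed

text \<open>The map on polynomials is injective, so it reflects the vanishing of sums. It also
  carries a common divisor together with the cofactors to \<open>B\<close>, so simplicity over
  \<open>B\<close> implies simplicity over \<open>A\<close>.\<close>

lemma circuit_reflects:
  assumes C: "depth3_circuit A n k d \<alpha> l"
    and \<alpha>': "\<And>i. i < k \<Longrightarrow> \<alpha>' i = g (\<alpha> i)"
    and l': "\<And>i j. i < k \<Longrightarrow> j < d \<Longrightarrow> l' i j = g \<circ> l i j"
  shows "simple_circuit B n k d \<alpha>' l' \<Longrightarrow> simple_circuit A n k d \<alpha> l"
    and "minimal_circuit B n k d \<alpha>' l' \<Longrightarrow> minimal_circuit A n k d \<alpha> l"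
    and "identity_circuit B n k d \<alpha>' l' \<Longrightarrow> identity_circuit A n k d \<alpha> l"
proof -
  let ?A = "mpoly_ring A n" and ?B = "mpoly_ring B n" and ?G = "\<lambda>P. g \<circ> P"
  interpret MA: domain ?A by (rule A.domain_mpoly_ring)
  interpret MB: domain ?B by (rule B.domain_mpoly_ring)
  interpret G: ring_hom_cring ?A ?B ?G
    using MA.is_cring MB.is_cring map_mpoly_hom
    by (simp add: ring_hom_cring_def ring_hom_cring_axioms_def)
  define T where "T = mult_term A n d \<alpha> l"
  define T' where "T' = mult_term B n d \<alpha>' l'"
  have W: "v \<in> linear_forms A n \<Longrightarrow> v \<in> carrier ?A" for v
    unfolding A.linear_forms_eq using A.linear_form_closed by blast
  have const: "A.indexed_const (\<alpha> i) \<in> carrier ?A" if "i < k" for i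
    using C that by (auto simp: depth3_circuit_def intro: A.indexed_pset.indexed_const)
  have l: "l i \<in> {..<d} \<rightarrow> carrier ?A" if "i < k" for i
    using C that W unfolding depth3_circuit_def by blast
  have T_closed: "T i \<in> carrier ?A" if "i < k" for i
    unfolding T_def mult_term_def by (intro MA.m_closed MA.finprod_closed const l that)
  have GT: "?G (T i) = T' i" if i: "i < k" for i
  proof -
    have "?G (T i) = ?G (A.indexed_const (\<alpha> i)) \<otimes>\<^bsub>?B\<^esub> ?G (\<Otimes>\<^bsub>?A\<^esub>j\<in>{..<d}. l i j)"
      unfolding T_def mult_term_def by (intro G.hom_mult MA.finprod_closed const l i)
    also have "?G (\<Otimes>\<^bsub>?A\<^esub>j\<in>{..<d}. l i j) = (\<Otimes>\<^bsub>?B\<^esub>j\<in>{..<d}. (?G \<circ> l i) j)"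
      by (rule G.hom_finprod[OF l[OF i]])
    also have "\<dots> = (\<Otimes>\<^bsub>?B\<^esub>j\<in>{..<d}. l' i j)"
    proof (rule MB.finprod_cong')
      show "l' i \<in> {..<d} \<rightarrow> carrier ?B"
      proof
        fix j assume "j \<in> {..<d}"
        then have "l i j \<in> carrier ?A" "l' i j = ?G (l i j)" using l[OF i] l'[OF i] by blast+
        then show "l' i j \<in> carrier ?B" using G.hom_closed by metis
      qed
    qed (use l'[OF i] in auto)
    also have "?G (A.indexed_const (\<alpha> i)) = B.indexed_const (\<alpha>' i)"
      using map_const \<alpha>'[OF i] by simp
    finally show ?thesis unfolding T'_def mult_term_def .
  qed
  have G_sum: "?G (\<Oplus>\<^bsub>?A\<^esub>i\<in>S. T i) = (\<Oplus>\<^bsub>?B\<^esub>i\<in>S. T' i)" if S: "S \<subseteq> {..<k}" for S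
  proof -
    have "?G (\<Oplus>\<^bsub>?A\<^esub>i\<in>S. T i) = (\<Oplus>\<^bsub>?B\<^esub>i\<in>S. (?G \<circ> T) i)"
      using S T_closed by (intro G.hom_finsum) blast
    also have "\<dots> = (\<Oplus>\<^bsub>?B\<^esub>i\<in>S. T' i)"
    proof (rule MB.add.finprod_cong')
      show "T' \<in> S \<rightarrow> carrier ?B"
      proof
        fix i assume "i \<in> S"
        then have "T i \<in> carrier ?A" "T' i = ?G (T i)" using S GT T_closed by auto
        then show "T' i \<in> carrier ?B" using G.hom_closed by metis
      qed
    qed (use S GT in auto)
    finally show ?thesis .
  qed
  have G_zero: "?G \<zero>\<^bsub>?A\<^esub> = \<zero>\<^bsub>?B\<^esub>" by (rule G.hom_zero)
  have sum_zero: "(\<Oplus>\<^bsub>?A\<^esub>i\<in>S. T i) = \<zero>\<^bsub>?A\<^esub> \<longleftrightarrow> (\<Oplus>\<^bsub>?B\<^esub>i\<in>S. T' i) = \<zero>\<^bsub>?B\<^esub>"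
    if S: "S \<subseteq> {..<k}" for S
  proof -
    have "(\<Oplus>\<^bsub>?A\<^esub>i\<in>S. T i) \<in> carrier ?A" using S T_closed by (intro MA.finsum_closed) blast
    then show ?thesis
      using G_sum[OF S] G_zero inj_onD[OF map_mpoly_inj, OF _ _ MA.zero_closed] by metis
  qed
  show "identity_circuit B n k d \<alpha>' l' \<Longrightarrow> identity_circuit A n k d \<alpha> l"
    using sum_zero[of "{..<k}"] unfolding identity_circuit_def T_def T'_def by blast
  show "minimal_circuit B n k d \<alpha>' l' \<Longrightarrow> minimal_circuit A n k d \<alpha> l"
    using sum_zero unfolding minimal_circuit_def T_def T'_def by (metis psubset_imp_subset)
  show "simple_circuit A n k d \<alpha> l" if B: "simple_circuit B n k d \<alpha>' l'"
    unfolding simple_circuit_def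
  proof
    assume "\<exists>u\<in>linear_forms A n - {\<zero>\<^bsub>?A\<^esub>}. \<forall>i<k. u divides\<^bsub>?A\<^esub> mult_term A n d \<alpha> l i"
    then obtain u where u: "u \<in> linear_forms A n" "u \<noteq> \<zero>\<^bsub>?A\<^esub>" "\<And>i. i < k \<Longrightarrow> u divides\<^bsub>?A\<^esub> T i"
      unfolding T_def by blast
    have "?G u \<noteq> \<zero>\<^bsub>?B\<^esub>"
      using u W G_zero inj_onD[OF map_mpoly_inj, OF _ _ MA.zero_closed] by metis
    moreover have "?G u divides\<^bsub>?B\<^esub> T' i" if "i < k" for i
    proof -
      obtain z where z: "z \<in> carrier ?A" "T i = u \<otimes>\<^bsub>?A\<^esub> z"
        using u(3)[OF \<open>i < k\<close>] by (auto simp: factor_def)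
      then have "T' i = ?G u \<otimes>\<^bsub>?B\<^esub> ?G z"
        using GT[OF \<open>i < k\<close>] G.hom_mult[OF W[OF u(1)] z(1)] by metis
      then show ?thesis using G.hom_closed[OF z(1)] unfolding factor_def by blast
    qed
    ultimately show False
      using B map_linear_forms[OF u(1)] unfolding simple_circuit_def T'_def by blast
  qed
qed

end

lemma (in field) rank_bound_descent:
  assumes nat: "\<forall>F :: nat ring. field F \<longrightarrow> rank_bound F c"
  shows "rank_bound R c"
  unfolding rank_bound_def
proof (intro allI impI)
  fix n k d \<alpha> l
  assume d: "2 \<le> d" and C: "depth3_circuit R n k d \<alpha> l" and simple: "simple_circuit R n k d \<alpha> l"
    and minimal: "minimal_circuit R n k d \<alpha> l" and identity: "identity_circuit R n k d \<alpha> l"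
  have "\<forall>i<k. \<forall>j<d. \<exists>a. a \<in> {..<n} \<rightarrow> carrier R \<and> l i j = linear_form n a"
    using C linear_formsE unfolding depth3_circuit_def by metis
  then obtain a where a: "\<And>i j. i < k \<Longrightarrow> j < d \<Longrightarrow> a i j \<in> {..<n} \<rightarrow> carrier R"
    "\<And>i j. i < k \<Longrightarrow> j < d \<Longrightarrow> l i j = linear_form n (a i j)"
    by metis
  \<comment> \<open>All scalars and coefficients of the circuit: a finite set, so the field it
    generates is countable.\<close>
  define H where "H = \<alpha> ` {..<k} \<union> (\<Union>i<k. \<Union>j<d. a i j ` {..<n})"
  have H: "H \<subseteq> carrier R"
    using C a(1) by (fastforce simp: H_def depth3_circuit_def)
  have "countable H" by (intro countable_finite) (simp add: H_def)
  define K where "K = generate_field R H"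
  have K: "subfield K R" unfolding K_def by (rule generate_field_is_subfield[OF H])
  have K_carrier: "K \<subseteq> carrier R" using subfieldE(3)[OF K] .
  have HK: "H \<subseteq> K" unfolding K_def by (intro subsetI generate_field.incl)
  \<comment> \<open>\<open>to_nat_on\<close> is injective on finite sets too, so finite and infinite
    \<open>K\<close> are treated alike.\<close>
  define e where "e = to_nat_on K"
  have e: "inj_on e K"
    unfolding e_def K_def using countable_generate_field[OF \<open>countable H\<close>] by (rule inj_on_to_nat_on)
  interpret K: field "R\<lparr>carrier := K\<rparr>" using subfield_iff(2)[OF K] .
  \<comment> \<open>A copy of \<open>K\<close> carried by natural numbers; \<open>g\<close> decodes
    it and is the embedding into the given field.\<close>
  define A where "A = image_ring e (R\<lparr>carrier := K\<rparr>)"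
  define g where "g = inv_into K e"
  have ge: "g (e x) = x" if "x \<in> K" for x unfolding g_def using e that by simp
  have A: "field A" unfolding A_def by (rule K.inj_imp_image_ring_is_field) (simp add: e)
  have "g \<in> ring_hom A R"
    unfolding A_def
  proof (rule ring_hom_memI)
    have cl: "x \<otimes> y \<in> K" "x \<oplus> y \<in> K" if "x \<in> K" "y \<in> K" for x y
      using that subringE(6,7)[OF subfieldE(1)[OF K]] by auto
    have gK: "g x \<in> K" if "x \<in> e ` K" for x using that ge by auto
    show "g x \<in> carrier R" if "x \<in> carrier (image_ring e (R\<lparr>carrier := K\<rparr>))" for x
      using that gK K_carrier by (auto simp: image_ring_carrier)
    show "g (x \<otimes>\<^bsub>image_ring e (R\<lparr>carrier := K\<rparr>)\<^esub> y) = g x \<otimes> g y"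
      and "g (x \<oplus>\<^bsub>image_ring e (R\<lparr>carrier := K\<rparr>)\<^esub> y) = g x \<oplus> g y"
      if "x \<in> carrier (image_ring e (R\<lparr>carrier := K\<rparr>))" "y \<in> carrier (image_ring e (R\<lparr>carrier := K\<rparr>))" for x y
      using that gK ge cl
      by (auto simp: image_ring_def image_group_def monoid.defs simp flip: g_def)
    show "g \<one>\<^bsub>image_ring e (R\<lparr>carrier := K\<rparr>)\<^esub> = \<one>"
      using ge subringE(3)[OF subfieldE(1)[OF K]] by (simp add: image_ring_one)
  qed
  then interpret E: field_embedding A R g
    using A field_axioms by (simp add: field_embedding_def field_embedding_axioms_def)
  define \<alpha>' where "\<alpha>' i = e (\<alpha> i)" for i
  define a' where "a' i j = (\<lambda>t. e (a i j t))" for i j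
  \<comment> \<open>Encoding the coefficients instead of the polynomials makes these linear forms
    over \<open>A\<close> at once, and \<open>map_linear_form\<close> leads back to
    \<open>l\<close>.\<close>
  define l' where "l' i j = E.A.linear_form n (a' i j)" for i j
  have A_carrier: "carrier A = e ` K" by (simp add: A_def image_ring_carrier)
  have \<alpha>': "\<alpha>' i \<in> carrier A - {\<zero>\<^bsub>A\<^esub>}" "\<alpha> i = g (\<alpha>' i)" if i: "i < k" for i
  proof -
    have "\<alpha> i \<in> H" using i by (simp add: H_def)
    then have "\<alpha> i \<in> K" using HK by (rule rev_subsetD)
    have "\<alpha> i \<noteq> \<zero>" using C i by (auto simp: depth3_circuit_def)
    show *: "\<alpha> i = g (\<alpha>' i)" using ge[OF \<open>\<alpha> i \<in> K\<close>] by (simp add: \<alpha>'_def)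
    have "\<alpha>' i \<in> carrier A" unfolding \<alpha>'_def A_carrier using \<open>\<alpha> i \<in> K\<close> by (rule imageI)
    moreover have "\<alpha>' i \<noteq> \<zero>\<^bsub>A\<^esub>" using * \<open>\<alpha> i \<noteq> \<zero>\<close> E.g_simps(2) by metis
    ultimately show "\<alpha>' i \<in> carrier A - {\<zero>\<^bsub>A\<^esub>}" by blast
  qed
  have aK: "a i j t \<in> K" if "i < k" "j < d" "t < n" for i j t
  proof -
    have "a i j t \<in> H" using that by (auto simp: H_def)
    then show ?thesis using HK by (rule rev_subsetD)
  qed
  have a': "a' i j \<in> {..<n} \<rightarrow> carrier A" if "i < k" "j < d" for i j
    unfolding a'_def A_carrier by (intro funcsetI imageI aK that) simp
  have l': "l i j = g \<circ> l' i j" if "i < k" "j < d" for i j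
  proof -
    have "g \<circ> a' i j \<in> {..<n} \<rightarrow> carrier R" using a'[OF that] by (auto simp: Pi_iff)
    then have "linear_form n (g \<circ> a' i j) = linear_form n (a i j)"
      using a(1)[OF that] aK[OF that] ge by (auto simp: linear_form_apply fun_eq_iff a'_def)
    then show ?thesis using E.map_linear_form[OF a'[OF that]] a(2)[OF that] by (simp add: l'_def)
  qed
  have C': "depth3_circuit A n k d \<alpha>' l'"
    using \<alpha>'(1) a' by (auto simp: depth3_circuit_def l'_def E.A.linear_forms_eq)
  have "rank_bound A c" using nat A by blast
  then have "real (circuit_rank A n k d l') \<le> c * real k ^ 3 * log 2 (real d)"
    unfolding rank_bound_def using d C' E.circuit_reflects[OF C' \<alpha>'(2) l'] simple minimal identity
    by blast
  moreover have "circuit_rank R n k d l \<le> circuit_rank A n k d l'"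
    by (rule E.circuit_rank_map[OF C' l'])
  ultimately show "real (circuit_rank R n k d l) \<le> c * real k ^ 3 * log 2 (real d)" by linarith
qed

theorem theorem1:
  shows "(\<exists>c>0. \<forall>F :: nat ring. field F \<longrightarrow> rank_bound F c) \<and>
    (\<forall>c. (\<forall>F :: nat ring. field F \<longrightarrow> rank_bound F c) \<longrightarrow>
         (\<forall>F :: 'a ring. field F \<longrightarrow> rank_bound F c))"
proof
  show "\<exists>c>0. \<forall>F :: nat ring. field F \<longrightarrow> rank_bound F c"
    using field.rank_bound_three by (intro exI[of _ 3]) auto
  show "\<forall>c. (\<forall>F :: nat ring. field F \<longrightarrow> rank_bound F c) \<longrightarrow>
      (\<forall>F :: 'a ring. field F \<longrightarrow> rank_bound F c)"
    using field.rank_bound_descent by blast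
qed


end
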